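(* For every integer $k\ge 2$ there exists an integer $n_k$ such that for every integer $n\ge n_k$ the graph $K_{2n,2n,C_5}$ is $k$-common.
   Context: For a graph $H$ write $|H|$ for its number of vertices and $\|H\|$ for its number of edges. For $n\ge1$, $K_{2n,2n,C_5}$ denotes the graph obtained from the complete bipartite graph $K_{2n,2n}$ by taking $n$ vertices $v_1,\dots,v_n$ of one of the two parts (every second vertex of that part) and, for each $i\in[n]$, adding a new copy of the cycle $C_5$ that shares exactly the vertex $v_i$ with the rest of the graph (the $n$ added cycles are pairwise vertex-disjoint apart from this). A graph $H$ is $k$-common if for every $k$-edge-coloring of the complete graph $K_N$ the number of monochromatic labeled copies of $H$ is at least $(1-o(1))N^{|H|}/k^{\|H\|-1}$ as $N\to\infty$. Equivalently, in graphon language: a graphon is a symmetric measurable $W:[0,1]^2\to[0,1]$, the homomorphism density is $t(H,W)=\int_{[0,1]^{V(H)}}\prod_{uv\in E(H)}W(x_u,x_v)\,dx_{V(H)}$, and $H$ is $k$-common iff $t(H,W_1)+\cdots+t(H,W_k)\ge k^{-\|H\|+1}$ for all graphons $W_1,\dots,W_k$ with $W_1+\cdots+W_k=1$ everywhere. *)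

theory Defs
  imports Complex_Main "HOL-Library.FuncSet"
begin

record 'a ugraph =
  vertices :: "'a set"
  edges :: "'a set set"

definition simple_graph :: "'a ugraph \<Rightarrow> bool" where
  "simple_graph H \<longleftrightarrow> finite (vertices H) \<and> (\<forall>e\<in>edges H. e \<subseteq> vertices H \<and> card e = 2)"

definition complete_graph :: "nat \<Rightarrow> nat ugraph" where
  "complete_graph N = \<lparr>vertices = {..<N}, edges = {e. e \<subseteq> {..<N} \<and> card e = 2}\<rparr>"

definition edge_colorings :: "nat \<Rightarrow> 'a ugraph \<Rightarrow> ('a set \<Rightarrow> nat) set" where
  "edge_colorings k G = edges G \<rightarrow> {..<k}"

(* Labeled copies of H are the injective maps V(H) \<rightarrow> V(G) sending edges to edges;
   being extensional, each one is counted once. *)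
definition monochromatic_copies ::
    "'a ugraph \<Rightarrow> 'b ugraph \<Rightarrow> ('b set \<Rightarrow> nat) \<Rightarrow> ('a \<Rightarrow> 'b) set" where
  "monochromatic_copies H G c =
     {f \<in> vertices H \<rightarrow>\<^sub>E vertices G. inj_on f (vertices H) \<and>
        (\<forall>e\<in>edges H. f ` e \<in> edges G) \<and>
        (\<exists>i. \<forall>e\<in>edges H. c (f ` e) = i)}"

(* The o(1) term is uniform over all colorings of K_N. For H without edges the truncated
   exponent is 0, which makes such H k-common. *)
definition k_common :: "nat \<Rightarrow> 'a ugraph \<Rightarrow> bool" where
  "k_common k H \<longleftrightarrow>
     (\<forall>\<epsilon>>0::real. \<forall>\<^sub>F N in sequentially. \<forall>c\<in>edge_colorings k (complete_graph N).
        real (card (monochromatic_copies H (complete_graph N) c))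
          \<ge> (1 - \<epsilon>) * real N ^ card (vertices H) / real k ^ (card (edges H) - 1))"

datatype vertex = PartA nat | PartB nat | New nat nat

(* The j-th vertex (j < 5) of the i-th added 5-cycle; the vertex with j = 0 is the one
   shared with the complete bipartite graph. *)
definition cycle_vertex :: "nat \<Rightarrow> nat \<Rightarrow> vertex" where
  "cycle_vertex i j = (if j = 0 then PartA (2 * i) else New i j)"

definition K_C5 :: "nat \<Rightarrow> vertex ugraph" where
  "K_C5 n =
     \<lparr>vertices = PartA ` {..<2 * n} \<union> PartB ` {..<2 * n} \<union> {cycle_vertex i j |i j. i < n \<and> j < 5},
      edges = {{PartA a, PartB b} |a b. a < 2 * n \<and> b < 2 * n} \<union>
              {{cycle_vertex i j, cycle_vertex i (Suc j mod 5)} |i j. i < n \<and> j < 5}\<rparr>"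

lemma simple_graph_K_C5: "simple_graph (K_C5 n)"
proof -
  have fin: "finite (vertices (K_C5 n))"
  proof -
    have "{cycle_vertex i j |i j. i < n \<and> j < 5} = (\<lambda>(i, j). cycle_vertex i j) ` ({..<n} \<times> {..<5})"
      by auto
    then show ?thesis by (simp add: K_C5_def)
  qed
  have five: "j = 0 \<or> j = 1 \<or> j = 2 \<or> j = 3 \<or> j = 4" if "j < 5" for j :: nat
    using that by linarith
  have "cycle_vertex i j \<noteq> cycle_vertex i (Suc j mod 5)" if "j < 5" for i j
    using five[OF that] by (elim disjE) (simp_all add: cycle_vertex_def)
  then have "card e = 2" if "e \<in> edges (K_C5 n)" for e
    using that by (auto simp: K_C5_def card_2_iff)
  moreover have "e \<subseteq> vertices (K_C5 n)" if "e \<in> edges (K_C5 n)" for e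
    using that by (force simp: K_C5_def)
  ultimately show ?thesis using fin by (auto simp: simple_graph_def)
qed

lemma card_vertices_K_C5: "card (vertices (K_C5 n)) = 8 * n"
proof -
  have eq: "vertices (K_C5 n) = PartA ` {..<2 * n} \<union> PartB ` {..<2 * n} \<union>
      (\<lambda>(i, j). New i j) ` ({..<n} \<times> {1..<5})"
    (is "_ = ?A \<union> ?B \<union> ?N")
  proof
    show "vertices (K_C5 n) \<subseteq> ?A \<union> ?B \<union> ?N"
      by (auto simp: K_C5_def cycle_vertex_def)
    have "New i j = cycle_vertex i j" if "j \<ge> 1" for i j
      using that by (simp add: cycle_vertex_def)
    then show "?A \<union> ?B \<union> ?N \<subseteq> vertices (K_C5 n)"
      by (fastforce simp: K_C5_def)
  qed
  have "card ((\<lambda>(i, j). New i j) ` ({..<n} \<times> {1..<5})) = 4 * n"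
    by (subst card_image) (auto simp: inj_on_def)
  moreover have "card (PartA ` {..<2 * n}) = 2 * n" "card (PartB ` {..<2 * n}) = 2 * n"
    by (simp_all add: card_image inj_on_def)
  ultimately show ?thesis
    unfolding eq by (subst card_Un_disjoint | auto)+
qed

lemma card_edges_K_C5: "card (edges (K_C5 n)) = 4 * n\<^sup>2 + 5 * n"
proof -
  define B where "B = (\<lambda>(a, b). {PartA a, PartB b}) ` ({..<2 * n} \<times> {..<2 * n})"
  define C where "C = (\<lambda>(i, j). {cycle_vertex i j, cycle_vertex i (Suc j mod 5)}) ` ({..<n} \<times> {..<5})"
  have eq: "edges (K_C5 n) = B \<union> C"
    by (auto simp: K_C5_def B_def C_def)
  have B: "card B = 4 * n\<^sup>2"
    unfolding B_def by (subst card_image) (auto simp: inj_on_def doubleton_eq_iff power2_eq_square)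
  have five: "j = 0 \<or> j = 1 \<or> j = 2 \<or> j = 3 \<or> j = 4" if "j < 5" for j :: nat
    using that by linarith
  have inj: "i = i' \<and> j = j'" if "j < 5" "j' < 5"
    and "{cycle_vertex i j, cycle_vertex i (Suc j mod 5)} =
         {cycle_vertex i' j', cycle_vertex i' (Suc j' mod 5)}" for i i' j j'
    using five[OF that(1)] five[OF that(2)] that(3)
    by (elim disjE) (simp_all add: cycle_vertex_def doubleton_eq_iff)
  have "inj_on (\<lambda>(i, j). {cycle_vertex i j, cycle_vertex i (Suc j mod 5)}) ({..<n} \<times> {..<5})"
    unfolding inj_on_def using inj by fast
  then have C: "card C = 5 * n"
    unfolding C_def by (subst card_image) auto
  have "B \<inter> C = {}"
  proof -
    have "{PartA a, PartB b} \<noteq> {cycle_vertex i j, cycle_vertex i (Suc j mod 5)}" for a b i j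
      by (simp add: doubleton_eq_iff cycle_vertex_def)
    then show ?thesis
      by (auto simp: B_def C_def)
  qed
  moreover have "finite B" "finite C"
    by (simp_all add: B_def C_def)
  ultimately show ?thesis
    by (simp add: eq card_Un_disjoint B C)
qed

end

theory Submission imports Defs "HOL-Analysis.Convex" begin

text \<open>Fix a colouring with colour classes \<open>w i\<close>, and let \<open>c i x\<close> be the density of closed
  5-walks in colour \<open>i\<close> from \<open>x\<close>. By Cauchy--Schwarz, the homomorphism density of \<open>K_{2n,2n,C_5}\<close>
  is at least that of \<open>K_{2n,2n}\<close> with weight \<open>sqrt (c i x)\<close> on each vertex of one part. If some
  vertex of not too small degree lies in few pentagons of colour \<open>i\<close>, then its neighbourhood
  contains almost no edges of colour \<open>i\<close>; iterating, one finds a set of linear size on which one of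
  the other \<open>k - 1\<close> colours has density above \<open>1 / (k - 1/2)\<close> and plenty of pentagons, and the exponent
  \<open>4 n\<^sup>2\<close> of the complete bipartite graph beats all losses, which are exponential in \<open>n\<close>. Otherwise
  two applications of Jensen's inequality reduce the problem to the density of \<open>C_4\<close> with vertex
  weights \<open>c i x powr (1 / (2 n))\<close>. There the loss due to the pentagons carries a factor \<open>1 / n\<close>
  and is absorbed, up to terms which cancel in the sum over the colours, by the gain in the \<open>C_4\<close>
  densities, which controls the variances of the degrees and codegrees.\<close>

section \<open>Averages over finite sets\<close>

definition avg :: "'a set \<Rightarrow> ('a \<Rightarrow> real) \<Rightarrow> real" where
  "avg V f = (\<Sum>x\<in>V. f x) / real (card V)"

lemma avg_add: "avg V (\<lambda>x. f x + g x) = avg V f + avg V g"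
  by (simp add: avg_def sum.distrib add_divide_distrib)

lemma avg_diff: "avg V (\<lambda>x. f x - g x) = avg V f - avg V g"
  by (simp add: avg_def sum_subtractf diff_divide_distrib)

lemma avg_cmult: "avg V (\<lambda>x. c * f x) = c * avg V f"
  by (simp add: avg_def sum_distrib_left)

lemma avg_multc: "avg V (\<lambda>x. f x * c) = avg V f * c"
  by (simp add: avg_def sum_distrib_right)

lemma avg_divide: "avg V (\<lambda>x. f x / c) = avg V f / c"
  by (simp add: avg_def flip: sum_divide_distrib)

lemma avg_swap: "avg V (\<lambda>x. avg W (\<lambda>y. f x y)) = avg W (\<lambda>y. avg V (\<lambda>x. f x y))"
  by (simp add: avg_def flip: sum_divide_distrib) (subst sum.swap, simp)

lemma avg_mono: "(\<And>x. x \<in> V \<Longrightarrow> f x \<le> g x) \<Longrightarrow> avg V f \<le> avg V g"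
  by (simp add: avg_def divide_right_mono sum_mono)

lemma avg_cong: "(\<And>x. x \<in> V \<Longrightarrow> f x = g x) \<Longrightarrow> avg V f = avg V g"
  by (simp add: avg_def)

lemma avg_nonneg: "(\<And>x. x \<in> V \<Longrightarrow> 0 \<le> f x) \<Longrightarrow> 0 \<le> avg V f"
  by (simp add: avg_def sum_nonneg)

lemma avg_const: "finite V \<Longrightarrow> V \<noteq> {} \<Longrightarrow> avg V (\<lambda>x. c) = c"
  by (simp add: avg_def)

lemma avg_sum: "avg V (\<lambda>x. \<Sum>i\<in>I. f i x) = (\<Sum>i\<in>I. avg V (f i))"
  by (simp add: avg_def sum_divide_distrib) (rule sum.swap)

lemmas avg_linear = avg_add avg_diff avg_cmult avg_multc avg_divide

section \<open>Convexity inequalities for averages\<close>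

lemma power_ge_tangent:
  fixes x a :: real
  assumes "x \<ge> 0" "a \<ge> 0"
  shows "x ^ Suc m \<ge> a ^ Suc m + real (Suc m) * a ^ m * (x - a)"
proof (induction m)
  case (Suc m)
  have "x * x ^ Suc m \<ge> x * (a ^ Suc m + real (Suc m) * a ^ m * (x - a))"
    using Suc assms(1) by (rule mult_left_mono)
  moreover have "x * (a ^ Suc m + real (Suc m) * a ^ m * (x - a)) =
      a ^ Suc (Suc m) + real (Suc (Suc m)) * a ^ Suc m * (x - a)
      + a ^ m * real (Suc m) * (x - a)\<^sup>2"
    by (simp add: algebra_simps power2_eq_square)
  moreover have "a ^ m * real (Suc m) * (x - a)\<^sup>2 \<ge> 0"
    using assms by simp
  ultimately show ?case
    by simp
qed simp

text \<open>Jensen's inequality: averaging the tangent line at the mean kills the linear term. A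
  positive exponent keeps the empty set harmless, since all its averages are 0.\<close>

lemma avg_power_le:
  assumes "finite V" "\<And>x. x \<in> V \<Longrightarrow> f x \<ge> 0"
  shows "avg V f ^ Suc m \<le> avg V (\<lambda>x. f x ^ Suc m)"
proof (cases "V = {}")
  case False
  define a where "a = avg V f"
  have "a \<ge> 0"
    unfolding a_def using assms by (intro avg_nonneg)
  then have "avg V (\<lambda>x. a ^ Suc m + real (Suc m) * a ^ m * (f x - a)) \<le> avg V (\<lambda>x. f x ^ Suc m)"
    using assms(2) by (intro avg_mono power_ge_tangent)
  then show ?thesis
    using assms(1) False by (simp add: avg_linear avg_const a_def del: power_Suc)
qed (simp add: avg_def)

lemma sum_power_le:
  assumes "finite V" "\<And>x. x \<in> V \<Longrightarrow> f x \<ge> (0::real)"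
  shows "(\<Sum>x\<in>V. f x) ^ Suc m \<le> real (card V) ^ m * (\<Sum>x\<in>V. f x ^ Suc m)"
proof (cases "V = {}")
  case False
  then have "card V > 0"
    using assms(1) by (simp add: card_gt_0_iff)
  then show ?thesis
    using avg_power_le[OF assms] by (simp add: avg_def power_divide field_simps)
qed simp

lemma avg_square_le:
  assumes "finite V"
  shows "(avg V f)\<^sup>2 \<le> avg V (\<lambda>x. (f x)\<^sup>2)"
proof (cases "V = {}")
  case False
  have "0 \<le> avg V (\<lambda>x. (f x - avg V f)\<^sup>2)"
    by (intro avg_nonneg) simp
  then show ?thesis
    using False assms by (simp add: power2_diff avg_linear avg_const) (simp add: power2_eq_square)
qed (simp add: avg_def)

section \<open>Degrees, codegrees and pentagons\<close>

definition deg :: "'a set \<Rightarrow> ('a \<Rightarrow> 'a \<Rightarrow> real) \<Rightarrow> 'a \<Rightarrow> real" where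
  "deg V u x = avg V (u x)"

definition codeg :: "'a set \<Rightarrow> ('a \<Rightarrow> 'a \<Rightarrow> real) \<Rightarrow> 'a \<Rightarrow> 'a \<Rightarrow> real" where
  "codeg V u x y = avg V (\<lambda>z. u x z * u z y)"

text \<open>The two neighbours of \<open>x\<close> on a closed 5-walk are averaged out inside the
  codegrees; \<open>y\<close> and \<open>z\<close> are the ends of the opposite edge.\<close>

definition pentagons :: "'a set \<Rightarrow> ('a \<Rightarrow> 'a \<Rightarrow> real) \<Rightarrow> 'a \<Rightarrow> real" where
  "pentagons V u x = avg V (\<lambda>y. avg V (\<lambda>z. codeg V u x y * u y z * codeg V u z x))"

text \<open>Symmetry and bounds hold on the whole type, which spares membership conditions in
  \<open>V\<close>. Weights in [0,1] suffice for the analytic part; values 0 and 1 enter when walks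
  are counted or neighbourhoods are taken.\<close>

locale kernel =
  fixes V :: "'a set" and u :: "'a \<Rightarrow> 'a \<Rightarrow> real"
  assumes fin: "finite V" and ne: "V \<noteq> {}"
    and sym: "u x y = u y x"
    and nonneg: "0 \<le> u x y" and le1: "u x y \<le> 1"
begin

abbreviation "E \<equiv> avg V"
abbreviation "d \<equiv> deg V u"
abbreviation "cd \<equiv> codeg V u"
abbreviation "c5 \<equiv> pentagons V u"

lemma E_const [simp]: "E (\<lambda>x. c) = c"
  using fin ne by (rule avg_const)

lemma d_nonneg: "0 \<le> d x"
  unfolding deg_def by (intro avg_nonneg nonneg)

lemma cd_nonneg: "0 \<le> cd x y"
  unfolding codeg_def by (intro avg_nonneg mult_nonneg_nonneg nonneg)

lemma cd_sym: "cd x y = cd y x"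
  unfolding codeg_def by (simp add: sym[of _ x] sym[of y] mult.commute)

lemma cd_le_d: "cd x y \<le> d x"
  unfolding codeg_def deg_def by (intro avg_mono) (simp add: mult_left_le le1 nonneg)

lemma d_le1: "d x \<le> 1"
  unfolding deg_def using avg_mono[of V "u x" "\<lambda>_. 1"] le1 by simp

lemma cd_le1: "cd x y \<le> 1"
  using cd_le_d d_le1 by (rule order_trans)

lemma c5_nonneg: "0 \<le> c5 x"
  unfolding pentagons_def by (intro avg_nonneg mult_nonneg_nonneg nonneg cd_nonneg)

lemma c5_le1: "c5 x \<le> 1"
proof -
  have "c5 x \<le> E (\<lambda>y. E (\<lambda>z. 1))"
    unfolding pentagons_def
    by (intro avg_mono mult_le_one mult_nonneg_nonneg nonneg cd_nonneg le1 cd_le1)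
  then show ?thesis by simp
qed

text \<open>Both sides are the density of two-edge walks, organised by the end vertices and by the
  middle vertex.\<close>

lemma E_cd: "E (\<lambda>x. E (\<lambda>y. cd x y)) = E (\<lambda>x. (d x)\<^sup>2)"
proof -
  have "E (\<lambda>x. E (\<lambda>y. cd x y)) = E (\<lambda>z. E (\<lambda>x. u x z) * d z)"
    unfolding codeg_def avg_swap[of V V "\<lambda>y z. u _ z * u z y"]
    by (subst avg_swap) (simp add: avg_linear deg_def)
  also have "(\<lambda>z. E (\<lambda>x. u x z)) = d"
    unfolding deg_def by (intro ext avg_cong sym)
  finally show ?thesis by (simp add: power2_eq_square)
qed

end

section \<open>Local analysis near the quasirandom kernel\<close>

context kernel
begin

text \<open>\<open>var p\<close> and \<open>disc p\<close> measure the distance of the kernel from a quasirandom one of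
  density \<open>p\<close>; every error term of the local analysis is bounded by them.\<close>

definition var :: "real \<Rightarrow> real" where
  "var p = E (\<lambda>x. (d x - p)\<^sup>2)"

definition disc :: "real \<Rightarrow> real" where
  "disc p = E (\<lambda>x. E (\<lambda>y. (cd x y - p\<^sup>2)\<^sup>2))"

lemma var_nonneg: "0 \<le> var p"
  unfolding var_def by (intro avg_nonneg) simp

lemma disc_nonneg: "0 \<le> disc p"
  unfolding disc_def by (intro avg_nonneg) simp

lemma E_d_diff_square: "(E d - p)\<^sup>2 \<le> var p"
  using avg_square_le[OF fin, of "\<lambda>x. d x - p"] by (simp add: avg_linear var_def)

lemma E_d_square: "E (\<lambda>x. (d x)\<^sup>2) = var p + p\<^sup>2 + 2 * p * (E d - p)"
proof -
  have "var p = E (\<lambda>x. (d x)\<^sup>2 + p\<^sup>2 - 2 * p * d x)"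
    unfolding var_def by (simp add: power2_diff mult_ac)
  then show ?thesis
    by (simp add: avg_linear) (simp add: algebra_simps power2_eq_square)
qed

text \<open>The left side is the density of \<open>C_4\<close>. Expanding \<open>disc p\<close> and
  using \<open>E_cd\<close> for the linear term exposes the gains
  \<open>2 * p\<^sup>2 * var p\<close> and \<open>disc p\<close>, which later pay for the
  losses.\<close>

lemma E_cd_square:
  "E (\<lambda>x. E (\<lambda>y. (cd x y)\<^sup>2)) = p ^ 4 + 2 * p\<^sup>2 * (var p + 2 * p * (E d - p)) + disc p"
proof -
  have "disc p = E (\<lambda>x. E (\<lambda>y. (cd x y)\<^sup>2 + p ^ 4 - 2 * p\<^sup>2 * cd x y))"
    unfolding disc_def by (simp add: power2_diff power_mult[symmetric] mult_ac)
  also have "\<dots> = E (\<lambda>x. E (\<lambda>y. (cd x y)\<^sup>2)) + p ^ 4 - 2 * p\<^sup>2 * E (\<lambda>x. E (cd x))"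
    by (simp add: avg_linear)
  finally show ?thesis
    unfolding E_cd E_d_square[of p] by (simp add: algebra_simps power2_eq_square power4_eq_xxxx)
qed

text \<open>With \<open>cd = p\<^sup>2 + r\<close>, the constant term and the terms linear in
  \<open>r\<close> produce the slope \<open>5 * p ^ 4\<close> of \<open>p ^ 5\<close>, up to degree
  deviations; the term quadratic in \<open>r\<close> is absorbed by \<open>disc p\<close>.\<close>

lemma E_pentagons_ge:
  assumes p: "0 \<le> p" "p \<le> 1"
  shows "E c5 - p ^ 5 \<ge> 5 * p ^ 4 * (E d - p) - 2 * disc p - var p"
proof -
  define r where "r x y = cd x y - p\<^sup>2" for x y
  have r_sym: "r x y = r y x" for x y
    by (simp add: r_def cd_sym)
  have disc: "disc p = E (\<lambda>x. E (\<lambda>y. (r x y)\<^sup>2))"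
    by (simp add: disc_def r_def)
  have d_alt: "E (\<lambda>z. u z y) = d y" for y
    unfolding deg_def by (intro avg_cong sym)
  define X where "X = E (\<lambda>x. E (\<lambda>y. r x y * d y))"
  have "cd x y * u y z * cd z x \<ge> p ^ 4 * u y z + p\<^sup>2 * (r x y * u y z) + p\<^sup>2 * (r x z * u z y)
          - ((r x y)\<^sup>2 + (r x z)\<^sup>2) / 2" for x y z
  proof -
    have "\<bar>r x y * r x z\<bar> \<le> ((r x y)\<^sup>2 + (r x z)\<^sup>2) / 2"
      using sum_squares_bound[of "\<bar>r x y\<bar>" "\<bar>r x z\<bar>"] by (simp add: abs_mult)
    then have "\<bar>r x y * r x z * u y z\<bar> \<le> ((r x y)\<^sup>2 + (r x z)\<^sup>2) / 2"
      using mult_left_le[of "u y z" "\<bar>r x y * r x z\<bar>"] nonneg[of y z] le1[of y z]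
      by (simp add: abs_mult)
    moreover have "cd x y * u y z * cd z x = p ^ 4 * u y z + p\<^sup>2 * (r x y * u y z)
        + p\<^sup>2 * (r x z * u z y) + r x y * r x z * u y z"
      unfolding r_def cd_sym[of z x] sym[of z y]
      by (simp add: algebra_simps power2_eq_square power4_eq_xxxx)
    ultimately show ?thesis by linarith
  qed
  then have "E c5 \<ge> E (\<lambda>x. E (\<lambda>y. E (\<lambda>z. p ^ 4 * u y z + p\<^sup>2 * (r x y * u y z)
      + p\<^sup>2 * (r x z * u z y) - ((r x y)\<^sup>2 + (r x z)\<^sup>2) / 2)))"
    unfolding pentagons_def by (intro avg_mono)
  also have "E (\<lambda>x. E (\<lambda>y. E (\<lambda>z. p ^ 4 * u y z + p\<^sup>2 * (r x y * u y z)
      + p\<^sup>2 * (r x z * u z y) - ((r x y)\<^sup>2 + (r x z)\<^sup>2) / 2)))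
      = p ^ 4 * E d + p\<^sup>2 * X + p\<^sup>2 * E (\<lambda>x. E (\<lambda>y. E (\<lambda>z. r x z * u z y))) - disc p"
    by (simp add: avg_linear X_def disc add_divide_distrib flip: deg_def)
  also have "E (\<lambda>x. E (\<lambda>y. E (\<lambda>z. r x z * u z y))) = X"
    unfolding X_def by (subst avg_swap[of V V "\<lambda>y z. r _ z * u z y"]) (simp add: avg_linear flip: deg_def)
  finally have 1: "E c5 \<ge> p ^ 4 * E d + 2 * p\<^sup>2 * X - disc p"
    by (simp add: algebra_simps)
  \<comment> \<open>The correlation of \<open>r\<close> with the degree deviation is split by the
    inequality of arithmetic and geometric means.\<close>
  have "r x y * d y \<ge> p * r x y - ((r x y)\<^sup>2 + (d y - p)\<^sup>2) / 2" for x y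
    using sum_squares_bound[of "- r x y" "d y - p"] by (simp add: field_simps)
  then have "X \<ge> E (\<lambda>x. E (\<lambda>y. p * r x y - ((r x y)\<^sup>2 + (d y - p)\<^sup>2) / 2))"
    unfolding X_def by (intro avg_mono)
  also have "E (\<lambda>x. E (\<lambda>y. p * r x y - ((r x y)\<^sup>2 + (d y - p)\<^sup>2) / 2))
      = p * E (\<lambda>x. E (r x)) - (disc p + var p) / 2"
    by (simp add: avg_linear disc var_def)
  also have "E (\<lambda>x. E (r x)) = var p + 2 * p * (E d - p)"
    using E_cd by (simp add: r_def[abs_def] avg_linear E_d_square[of p])
  \<comment> \<open>The nonnegative summand \<open>p * var p\<close> is dropped here.\<close>
  finally have "X \<ge> p * (2 * p * (E d - p)) - (disc p + var p) / 2"
    using mult_nonneg_nonneg[OF p(1) var_nonneg[of p]] by (simp add: algebra_simps)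
  then have "2 * p\<^sup>2 * X \<ge> 2 * p\<^sup>2 * (p * (2 * p * (E d - p)) - (disc p + var p) / 2)"
    by (intro mult_left_mono) auto
  also have "2 * p\<^sup>2 * (p * (2 * p * (E d - p)) - (disc p + var p) / 2) =
      4 * p ^ 4 * (E d - p) - p\<^sup>2 * (disc p + var p)"
    by (simp add: algebra_simps power2_eq_square power4_eq_xxxx)
  finally have 2: "2 * p\<^sup>2 * X \<ge> 4 * p ^ 4 * (E d - p) - p\<^sup>2 * (disc p + var p)" .
  have "p\<^sup>2 * (disc p + var p) \<le> 1 * (disc p + var p)"
    using p disc_nonneg[of p] var_nonneg[of p] by (intro mult_right_mono power_le_one) auto
  then have "E c5 \<ge> p ^ 4 * E d + 4 * p ^ 4 * (E d - p) - 2 * disc p - var p"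
    using 1 2 by simp
  moreover have "p ^ 4 * E d - p ^ 5 = p ^ 4 * (E d - p)"
    by (simp add: algebra_simps eval_nat_numeral)
  ultimately show ?thesis
    by argo
qed

text \<open>\<open>c5 x - p ^ 5\<close> splits into an error \<open>A\<close> from replacing both
  codegrees by \<open>p\<^sup>2\<close> and the density error \<open>p ^ 4 * (E d - p)\<close>.
  Cauchy-Schwarz bounds \<open>A\<close> by the codegree deviations at \<open>x\<close>, whose
  average is \<open>disc p\<close>.\<close>

lemma E_pentagons_diff_square:
  assumes p: "0 \<le> p" "p \<le> 1"
  shows "E (\<lambda>x. (c5 x - p ^ 5)\<^sup>2) \<le> 8 * disc p + 2 * var p"
proof -
  define r where "r x y = cd x y - p\<^sup>2" for x y
  have "(c5 x - p ^ 5)\<^sup>2 \<le> 8 * E (\<lambda>y. (r x y)\<^sup>2) + 2 * var p" for x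
  proof -
    define A where "A = E (\<lambda>y. E (\<lambda>z. (cd x y * cd z x - p ^ 4) * u y z))"
    have "A = E (\<lambda>y. E (\<lambda>z. cd x y * u y z * cd z x - p ^ 4 * u y z))"
      unfolding A_def by (simp add: algebra_simps)
    then have c: "c5 x - p ^ 5 = A + p ^ 4 * (E d - p)"
      by (simp add: avg_linear pentagons_def flip: deg_def) (simp add: eval_nat_numeral algebra_simps)
    have "((cd x y * cd z x - p ^ 4) * u y z)\<^sup>2 \<le> 2 * (r x y)\<^sup>2 + 2 * (r x z)\<^sup>2" for y z
    proof -
      have "cd x y * cd z x - p ^ 4 = r x y * cd z x + p\<^sup>2 * r x z"
        by (simp add: r_def cd_sym[of z x] algebra_simps power2_eq_square power4_eq_xxxx)
      moreover have "\<bar>r x y * cd z x\<bar> \<le> \<bar>r x y\<bar>" "\<bar>p\<^sup>2 * r x z\<bar> \<le> \<bar>r x z\<bar>"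
        using cd_nonneg cd_le1 p
        by (auto simp: abs_mult mult_left_le mult_left_le_one_le power_le_one)
      ultimately have "\<bar>cd x y * cd z x - p ^ 4\<bar> \<le> \<bar>r x y\<bar> + \<bar>r x z\<bar>"
        by linarith
      moreover have "\<bar>(cd x y * cd z x - p ^ 4) * u y z\<bar> \<le> \<bar>cd x y * cd z x - p ^ 4\<bar>"
        using nonneg le1 by (simp add: abs_mult mult_left_le)
      ultimately have "\<bar>(cd x y * cd z x - p ^ 4) * u y z\<bar> \<le> \<bar>r x y\<bar> + \<bar>r x z\<bar>"
        by linarith
      then have "((cd x y * cd z x - p ^ 4) * u y z)\<^sup>2 \<le> (\<bar>r x y\<bar> + \<bar>r x z\<bar>)\<^sup>2"
        by (metis abs_ge_zero power2_abs power_mono)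
      also have "\<dots> \<le> 2 * (r x y)\<^sup>2 + 2 * (r x z)\<^sup>2"
        using sum_squares_bound[of "\<bar>r x y\<bar>" "\<bar>r x z\<bar>"] by (simp add: power2_sum)
      finally show ?thesis .
    qed
    then have "E (\<lambda>y. E (\<lambda>z. ((cd x y * cd z x - p ^ 4) * u y z)\<^sup>2))
        \<le> E (\<lambda>y. E (\<lambda>z. 2 * (r x y)\<^sup>2 + 2 * (r x z)\<^sup>2))"
      by (intro avg_mono)
    also have "\<dots> = 4 * E (\<lambda>y. (r x y)\<^sup>2)"
      by (simp add: avg_linear)
    finally have "E (\<lambda>y. E (\<lambda>z. ((cd x y * cd z x - p ^ 4) * u y z)\<^sup>2)) \<le> 4 * E (\<lambda>y. (r x y)\<^sup>2)" .
    moreover have "A\<^sup>2 \<le> E (\<lambda>y. (E (\<lambda>z. (cd x y * cd z x - p ^ 4) * u y z))\<^sup>2)"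
      unfolding A_def by (rule avg_square_le[OF fin])
    moreover have "\<dots> \<le> E (\<lambda>y. E (\<lambda>z. ((cd x y * cd z x - p ^ 4) * u y z)\<^sup>2))"
      by (intro avg_mono avg_square_le[OF fin])
    ultimately have A: "A\<^sup>2 \<le> 4 * E (\<lambda>y. (r x y)\<^sup>2)"
      by linarith
    have "p ^ 4 \<le> 1"
      using p by (simp add: power_le_one)
    then have "\<bar>p ^ 4 * (E d - p)\<bar> \<le> \<bar>E d - p\<bar>"
      using p by (simp add: abs_mult mult_left_le_one_le)
    then have "(p ^ 4 * (E d - p))\<^sup>2 \<le> (E d - p)\<^sup>2"
      using abs_le_square_iff by blast
    then have B: "(p ^ 4 * (E d - p))\<^sup>2 \<le> var p"
      using E_d_diff_square by (rule order_trans)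
    have "(c5 x - p ^ 5)\<^sup>2 \<le> 2 * A\<^sup>2 + 2 * (p ^ 4 * (E d - p))\<^sup>2"
      unfolding c power2_sum using sum_squares_bound[of A "p ^ 4 * (E d - p)"] by linarith
    then show ?thesis
      using A B by linarith
  qed
  then have "E (\<lambda>x. (c5 x - p ^ 5)\<^sup>2) \<le> E (\<lambda>x. 8 * E (\<lambda>y. (r x y)\<^sup>2) + 2 * var p)"
    by (intro avg_mono)
  then show ?thesis
    by (simp add: avg_linear disc_def r_def)
qed

text \<open>The factor \<open>cd x y + p\<^sup>2\<close> is at most 2, so squaring the codegrees at
  most doubles their deviation.\<close>

lemma E_cd_square_diff_square:
  assumes p: "0 \<le> p" "p \<le> 1"
  shows "E (\<lambda>x. (E (\<lambda>y. (cd x y)\<^sup>2) - p ^ 4)\<^sup>2) \<le> 4 * disc p"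
proof -
  have "(E (\<lambda>y. (cd x y)\<^sup>2) - p ^ 4)\<^sup>2 \<le> 4 * E (\<lambda>y. (cd x y - p\<^sup>2)\<^sup>2)" for x
  proof -
    have "((cd x y)\<^sup>2 - p ^ 4)\<^sup>2 \<le> 4 * (cd x y - p\<^sup>2)\<^sup>2" for y
    proof -
      have "(cd x y)\<^sup>2 - p ^ 4 = (cd x y + p\<^sup>2) * (cd x y - p\<^sup>2)"
        by (simp add: algebra_simps power2_eq_square power4_eq_xxxx)
      moreover have "p\<^sup>2 \<le> 1"
        using p by (simp add: power_le_one)
      then have "(cd x y + p\<^sup>2)\<^sup>2 \<le> 2\<^sup>2"
        using cd_nonneg[of x y] cd_le1[of x y] by (intro power_mono) auto
      ultimately show ?thesis
        by (simp add: power_mult_distrib mult_right_mono)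
    qed
    then have "E (\<lambda>y. ((cd x y)\<^sup>2 - p ^ 4)\<^sup>2) \<le> E (\<lambda>y. 4 * (cd x y - p\<^sup>2)\<^sup>2)"
      by (intro avg_mono)
    moreover have "(E (\<lambda>y. (cd x y)\<^sup>2) - p ^ 4)\<^sup>2 \<le> E (\<lambda>y. ((cd x y)\<^sup>2 - p ^ 4)\<^sup>2)"
      using avg_square_le[OF fin, of "\<lambda>y. (cd x y)\<^sup>2 - p ^ 4"] by (simp add: avg_linear)
    ultimately show ?thesis
      by (simp add: avg_linear)
  qed
  then have "E (\<lambda>x. (E (\<lambda>y. (cd x y)\<^sup>2) - p ^ 4)\<^sup>2) \<le> E (\<lambda>x. 4 * E (\<lambda>y. (cd x y - p\<^sup>2)\<^sup>2))"
    by (intro avg_mono)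
  then show ?thesis
    by (simp add: avg_linear disc_def)
qed

end

text \<open>The standard bound \<open>ln (1 + b) \<ge> 1 - 1 / (1 + b)\<close> equals
  \<open>b - b\<^sup>2 / (1 + b)\<close>, and \<open>K\<close> bounds the inverse of the
  denominator.\<close>

lemma ln_ge_minus_square:
  fixes b K :: real
  assumes "1 + b > 0" "1 \<le> K * (1 + b)"
  shows "ln (1 + b) \<ge> b - K * b\<^sup>2"
proof -
  have "ln (1 / (1 + b)) \<le> 1 / (1 + b) - 1"
    using assms by (intro ln_le_minus_one) simp
  then have "ln (1 + b) \<ge> 1 - 1 / (1 + b)"
    using assms by (simp add: ln_div)
  moreover have "1 - 1 / (1 + b) = b - b\<^sup>2 / (1 + b)"
    using assms by (simp add: field_simps power2_eq_square)
  moreover have "b\<^sup>2 * 1 \<le> b\<^sup>2 * (K * (1 + b))"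
    using assms by (intro mult_left_mono) auto
  then have "b\<^sup>2 / (1 + b) \<le> K * b\<^sup>2"
    using assms by (simp add: field_simps)
  ultimately show ?thesis by linarith
qed

context kernel
begin

text \<open>The right-hand side is the tangent line of \<open>q \<mapsto> q powr (4 + 10 * \<beta>)\<close> at \<open>p\<close>, so that the
  linear terms cancel when densities summing to 1 are compared with the uniform one.\<close>

lemma weighted_C4_ge:
  fixes p \<gamma> \<beta> :: real
  defines "K \<equiv> p ^ 5 / \<gamma>"
  assumes p: "0 < p" "p \<le> 1/2" and \<gamma>: "0 < \<gamma>" and \<beta>: "0 \<le> \<beta>"
    and good: "\<And>x. x \<in> V \<Longrightarrow> d x < p\<^sup>2 / 4 \<or> \<gamma> \<le> c5 x"
    and small1: "\<beta> * (1 / p ^ 5 + K / p ^ 10) \<le> 1 / 4"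
    and small2: "\<beta> * (4 / p + (1 + 2 * K) * (8 / p ^ 10) + 4) \<le> p\<^sup>2"
  shows "E (\<lambda>x. E (\<lambda>y. c5 x powr \<beta> * c5 y powr \<beta> * (cd x y)\<^sup>2))
     \<ge> p powr (10 * \<beta>) * (p ^ 4 + (4 + 10 * \<beta>) * p ^ 3 * (E d - p))"
proof -
  \<comment> \<open>\<open>b\<close> is the relative deviation of the pentagon density from
    \<open>p ^ 5\<close>, \<open>l\<close> a quadratic minorant of \<open>ln (1 + b)\<close> where
    pentagons are plentiful, and \<open>P\<close> the product of two weights with
    \<open>c5 = p ^ 5\<close>.\<close>
  define b where "b x = c5 x / p ^ 5 - 1" for x
  define l where "l x = b x - K * (b x)\<^sup>2" for x
  define q where "q x = E (\<lambda>y. (cd x y)\<^sup>2)" for x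
  define P where "P = p powr (10 * \<beta>)"
  have K: "0 < K"
    using p \<gamma> by (simp add: K_def)
  have P: "0 < P"
    using p by (simp add: P_def)
  have p5: "0 < p ^ 5" "p ^ 5 \<le> 1"
    using p by (auto simp: power_le_one)
  have b_bound: "\<bar>b x\<bar> \<le> 1 / p ^ 5" for x
  proof -
    have "0 \<le> c5 x / p ^ 5" "c5 x / p ^ 5 \<le> 1 / p ^ 5" "1 \<le> 1 / p ^ 5"
      using p5 c5_nonneg[of x] c5_le1[of x] by (auto simp: divide_right_mono)
    then show ?thesis by (simp add: b_def abs_le_iff)
  qed
  have l_bound: "\<bar>l x\<bar> \<le> 1 / p ^ 5 + K / p ^ 10" for x
  proof -
    have "\<bar>b x\<bar>\<^sup>2 \<le> (1 / p ^ 5)\<^sup>2"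
      using b_bound by (intro power_mono) auto
    then have "(b x)\<^sup>2 \<le> 1 / p ^ 10"
      by (simp add: power_divide flip: power_mult)
    then have "K * (b x)\<^sup>2 \<le> K / p ^ 10"
      using K mult_left_mono[of "(b x)\<^sup>2" "1 / p ^ 10" K] by simp
    moreover have "0 \<le> K * (b x)\<^sup>2"
      using K by simp
    ultimately show ?thesis
      unfolding l_def using b_bound[of x] by linarith
  qed
  have bl_bound: "\<beta> * \<bar>l x\<bar> \<le> 1 / 4" for x
    using mult_left_mono[OF l_bound \<beta>] small1 by (rule order_trans)

  have pointwise: "c5 x powr \<beta> * c5 y powr \<beta> * (cd x y)\<^sup>2
      \<ge> P * ((1 + \<beta> * (l x + l y)) * (cd x y)\<^sup>2 - p\<^sup>2 / 2 * ((d x - p)\<^sup>2 + (d y - p)\<^sup>2))"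
    if xy: "x \<in> V" "y \<in> V" for x y
  proof (cases "\<gamma> \<le> c5 x \<and> \<gamma> \<le> c5 y")
    case True
    have step: "c5 z powr \<beta> = p powr (5 * \<beta>) * exp (\<beta> * ln (1 + b z)) \<and> ln (1 + b z) \<ge> l z"
      if z: "\<gamma> \<le> c5 z" for z
    proof -
      have pos: "0 < 1 + b z"
        using z \<gamma> p by (simp add: b_def)
      have "c5 z = p ^ 5 * (1 + b z)"
        using p by (simp add: b_def)
      then have "c5 z powr \<beta> = (p ^ 5) powr \<beta> * (1 + b z) powr \<beta>"
        using p pos by (simp add: powr_mult)
      also have "(p ^ 5) powr \<beta> = p powr (5 * \<beta>)"
        using p powr_realpow[of p 5] by (metis of_nat_numeral powr_powr)
      also have "(1 + b z) powr \<beta> = exp (\<beta> * ln (1 + b z))"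
        using pos by (simp add: powr_def)
      finally have "c5 z powr \<beta> = p powr (5 * \<beta>) * exp (\<beta> * ln (1 + b z))" .
      moreover have "1 \<le> K * (1 + b z)"
        using z \<gamma> p by (simp add: K_def b_def field_simps)
      then have "ln (1 + b z) \<ge> l z"
        unfolding l_def by (intro ln_ge_minus_square pos)
      ultimately show ?thesis by blast
    qed
    have "c5 x powr \<beta> * c5 y powr \<beta> = P * exp (\<beta> * (ln (1 + b x) + ln (1 + b y)))"
      using step[of x] step[of y] True
      by (simp add: P_def exp_add distrib_left mult_ac flip: powr_add)
    also have "\<dots> \<ge> P * (1 + \<beta> * (l x + l y))"
    proof (intro mult_left_mono)
      have "1 + \<beta> * (l x + l y) \<le> 1 + \<beta> * (ln (1 + b x) + ln (1 + b y))"
        using step[of x] step[of y] True \<beta> by (intro add_left_mono mult_left_mono add_mono) auto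
      also have "\<dots> \<le> exp (\<beta> * (ln (1 + b x) + ln (1 + b y)))"
        by (rule exp_ge_add_one_self)
      finally show "1 + \<beta> * (l x + l y) \<le> exp (\<beta> * (ln (1 + b x) + ln (1 + b y)))" .
    qed (use P in simp)
    finally have "c5 x powr \<beta> * c5 y powr \<beta> * (cd x y)\<^sup>2 \<ge> P * (1 + \<beta> * (l x + l y)) * (cd x y)\<^sup>2"
      by (intro mult_right_mono) auto
    moreover have "P * (p\<^sup>2 / 2 * ((d x - p)\<^sup>2 + (d y - p)\<^sup>2)) \<ge> 0"
      using P by simp
    ultimately show ?thesis
      by (simp add: algebra_simps)
  next
    case False
    \<comment> \<open>A vertex of low degree contributes little, and its deviation from \<open>p\<close> pays for it.\<close>
    have "\<exists>z\<in>{x, y}. d z < p\<^sup>2 / 4"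
      using False good[OF xy(1)] good[OF xy(2)] by auto
    then obtain z where z: "z = x \<or> z = y" and dz: "d z < p\<^sup>2 / 4"
      by auto
    have "cd x y \<le> d z"
      using z cd_le_d[of x y] cd_le_d[of y x] cd_sym[of x y] by auto
    then have "(cd x y)\<^sup>2 \<le> (p\<^sup>2 / 4)\<^sup>2"
      using dz cd_nonneg[of x y] by (intro power_mono) auto
    moreover have "p\<^sup>2 \<le> p * (1 / 2)"
      using p by (simp add: power2_eq_square)
    then have "p / 2 \<le> p - d z"
      using dz p by simp
    then have "(p / 2)\<^sup>2 \<le> (p - d z)\<^sup>2"
      using p by (intro power_mono) auto
    then have "p\<^sup>2 / 4 \<le> (d x - p)\<^sup>2 + (d y - p)\<^sup>2"
      using z by (auto simp: power_divide power2_commute intro: order_trans add_increasing add_increasing2)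
    then have "p\<^sup>2 / 2 * (p\<^sup>2 / 4) \<le> p\<^sup>2 / 2 * ((d x - p)\<^sup>2 + (d y - p)\<^sup>2)"
      by (intro mult_left_mono) auto
    moreover have "p\<^sup>2 / 2 * (p\<^sup>2 / 4) = 2 * (p\<^sup>2 / 4)\<^sup>2"
      by (simp add: power2_eq_square)
    ultimately have 1: "2 * (cd x y)\<^sup>2 \<le> p\<^sup>2 / 2 * ((d x - p)\<^sup>2 + (d y - p)\<^sup>2)"
      by linarith
    have "\<beta> * l x \<le> \<beta> * \<bar>l x\<bar>" "\<beta> * l y \<le> \<beta> * \<bar>l y\<bar>"
      using \<beta> by (auto intro: mult_left_mono)
    then have "1 + \<beta> * (l x + l y) \<le> 2"
      using bl_bound[of x] bl_bound[of y] by (simp add: distrib_left)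
    then have "(1 + \<beta> * (l x + l y)) * (cd x y)\<^sup>2 \<le> 2 * (cd x y)\<^sup>2"
      by (intro mult_right_mono) auto
    then have "P * ((1 + \<beta> * (l x + l y)) * (cd x y)\<^sup>2 - p\<^sup>2 / 2 * ((d x - p)\<^sup>2 + (d y - p)\<^sup>2)) \<le> 0"
      using 1 P by (intro mult_nonneg_nonpos) auto
    then show ?thesis
      by (rule order_trans) simp
  qed

  \<comment> \<open>Writing \<open>q = p ^ 4 + (q - p ^ 4)\<close>, the main part
    \<open>p ^ 4 * b\<close> averages to the slope \<open>5 * p ^ 3\<close>, and the mixed products
    become squares controlled by \<open>disc p\<close> and \<open>var p\<close>.\<close>
  have lq: "E (\<lambda>x. l x * q x) \<ge> 5 * p ^ 3 * (E d - p) - (2 / p + (1 / 2 + K) * (8 / p ^ 10) + 2) * disc p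
      - (1 / p + (1 / 2 + K) * (2 / p ^ 10)) * var p"
  proof -
    have "l x * q x \<ge> p ^ 4 * b x - (1 / 2 + K) * (b x)\<^sup>2 - (q x - p ^ 4)\<^sup>2 / 2" for x
    proof -
      have "E (\<lambda>y. (cd x y)\<^sup>2) \<le> E (\<lambda>y. 1)"
        using cd_nonneg cd_le1 by (intro avg_mono power_le_one)
      then have "q x \<le> 1"
        by (simp add: q_def)
      then have "K * (b x)\<^sup>2 * q x \<le> K * (b x)\<^sup>2 * 1"
        using K by (intro mult_left_mono) auto
      moreover have "b x * (q x - p ^ 4) \<ge> - ((b x)\<^sup>2 + (q x - p ^ 4)\<^sup>2) / 2"
        using sum_squares_bound[of "- b x" "q x - p ^ 4"] by simp
      ultimately show ?thesis
        unfolding l_def by (simp add: algebra_simps add_divide_distrib diff_divide_distrib)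
    qed
    then have "E (\<lambda>x. l x * q x) \<ge> E (\<lambda>x. p ^ 4 * b x - (1 / 2 + K) * (b x)\<^sup>2 - (q x - p ^ 4)\<^sup>2 / 2)"
      by (intro avg_mono)
    also have "E (\<lambda>x. p ^ 4 * b x - (1 / 2 + K) * (b x)\<^sup>2 - (q x - p ^ 4)\<^sup>2 / 2)
        = p ^ 4 * E b - (1 / 2 + K) * E (\<lambda>x. (b x)\<^sup>2) - E (\<lambda>x. (q x - p ^ 4)\<^sup>2) / 2"
      by (simp add: avg_linear)
    finally have main: "E (\<lambda>x. l x * q x) \<ge>
        p ^ 4 * E b - (1 / 2 + K) * E (\<lambda>x. (b x)\<^sup>2) - E (\<lambda>x. (q x - p ^ 4)\<^sup>2) / 2" .
    have p01: "0 \<le> p" "p \<le> 1"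
      using p by auto
    have "p ^ 4 * E b = (E c5 - p ^ 5) / p"
      using p by (simp add: b_def[abs_def] avg_linear field_simps eval_nat_numeral)
    also have "\<dots> \<ge> (5 * p ^ 4 * (E d - p) - 2 * disc p - var p) / p"
      using E_pentagons_ge[OF p01] p by (intro divide_right_mono) auto
    also have "(5 * p ^ 4 * (E d - p) - 2 * disc p - var p) / p
        = 5 * p ^ 3 * (E d - p) - 2 / p * disc p - 1 / p * var p"
      using p by (simp add: diff_divide_distrib) (simp add: eval_nat_numeral)
    finally have Eb: "p ^ 4 * E b \<ge> 5 * p ^ 3 * (E d - p) - 2 / p * disc p - 1 / p * var p" .
    have "(b x)\<^sup>2 = (c5 x - p ^ 5)\<^sup>2 / p ^ 10" for x
    proof -
      have "b x = (c5 x - p ^ 5) / p ^ 5"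
        using p by (simp add: b_def field_simps)
      then show ?thesis
        by (simp add: power_divide flip: power_mult)
    qed
    then have "E (\<lambda>x. (b x)\<^sup>2) \<le> (8 * disc p + 2 * var p) / p ^ 10"
      using E_pentagons_diff_square[OF p01] p by (simp add: avg_linear divide_right_mono)
    then have "(1 / 2 + K) * E (\<lambda>x. (b x)\<^sup>2) \<le> (1 / 2 + K) * ((8 * disc p + 2 * var p) / p ^ 10)"
      using K by (intro mult_left_mono) auto
    also have "\<dots> = (1 / 2 + K) * (8 / p ^ 10) * disc p + (1 / 2 + K) * (2 / p ^ 10) * var p"
      by (simp add: add_divide_distrib algebra_simps)
    finally have Eb2: "(1 / 2 + K) * E (\<lambda>x. (b x)\<^sup>2)
        \<le> (1 / 2 + K) * (8 / p ^ 10) * disc p + (1 / 2 + K) * (2 / p ^ 10) * var p" .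
    have "E (\<lambda>x. (q x - p ^ 4)\<^sup>2) / 2 \<le> 2 * disc p"
      using E_cd_square_diff_square[OF p01] by (simp add: q_def)
    then show ?thesis
      using main Eb Eb2 unfolding distrib_right by linarith
  qed

  have "E (\<lambda>x. E (\<lambda>y. c5 x powr \<beta> * c5 y powr \<beta> * (cd x y)\<^sup>2)) \<ge>
     E (\<lambda>x. E (\<lambda>y. P * ((1 + \<beta> * (l x + l y)) * (cd x y)\<^sup>2 - p\<^sup>2 / 2 * ((d x - p)\<^sup>2 + (d y - p)\<^sup>2))))"
    by (intro avg_mono pointwise)
  also have "E (\<lambda>x. E (\<lambda>y. P * ((1 + \<beta> * (l x + l y)) * (cd x y)\<^sup>2 - p\<^sup>2 / 2 * ((d x - p)\<^sup>2 + (d y - p)\<^sup>2))))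
     = P * (E (\<lambda>x. E (\<lambda>y. (cd x y)\<^sup>2)) + 2 * \<beta> * E (\<lambda>x. l x * q x) - p\<^sup>2 * var p)"
  proof -
    have swap: "E (\<lambda>x. E (\<lambda>y. l y * (cd x y)\<^sup>2)) = E (\<lambda>x. l x * q x)"
      by (subst avg_swap) (simp add: avg_linear q_def cd_sym[of _ "_::'a"] cong: avg_cong)
    have "(1 + \<beta> * (l x + l y)) * (cd x y)\<^sup>2 =
        (cd x y)\<^sup>2 + \<beta> * (l x * (cd x y)\<^sup>2) + \<beta> * (l y * (cd x y)\<^sup>2)" for x y
      by (simp add: algebra_simps)
    then show ?thesis
      using swap by (simp add: avg_linear flip: q_def var_def)
  qed
  finally have Q: "E (\<lambda>x. E (\<lambda>y. c5 x powr \<beta> * c5 y powr \<beta> * (cd x y)\<^sup>2))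
      \<ge> P * (E (\<lambda>x. E (\<lambda>y. (cd x y)\<^sup>2)) + 2 * \<beta> * E (\<lambda>x. l x * q x) - p\<^sup>2 * var p)" .

  \<comment> \<open>\<open>M\<close> is twice the coefficient of \<open>disc p\<close> in
    \<open>lq\<close> and at least twice that of \<open>var p\<close>.\<close>
  define M where "M = 4 / p + (1 + 2 * K) * (8 / p ^ 10) + 4"
  have \<beta>lq: "2 * \<beta> * E (\<lambda>x. l x * q x) \<ge> 10 * \<beta> * p ^ 3 * (E d - p) - \<beta> * M * disc p - \<beta> * M * var p"
  proof -
    have "(1 / p + (1 / 2 + K) * (2 / p ^ 10)) \<le> M / 2"
      using p K by (simp add: M_def field_simps)
    then have "(1 / p + (1 / 2 + K) * (2 / p ^ 10)) * var p \<le> M / 2 * var p"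
      by (intro mult_right_mono var_nonneg)
    moreover have M: "2 / p + (1 / 2 + K) * (8 / p ^ 10) + 2 = M / 2"
      by (simp add: M_def algebra_simps add_divide_distrib)
    ultimately have "E (\<lambda>x. l x * q x) \<ge> 5 * p ^ 3 * (E d - p) - M / 2 * disc p - M / 2 * var p"
      using lq unfolding M by linarith
    then have "2 * \<beta> * E (\<lambda>x. l x * q x) \<ge>
        2 * \<beta> * (5 * p ^ 3 * (E d - p) - M / 2 * disc p - M / 2 * var p)"
      using \<beta> by (intro mult_left_mono) auto
    then show ?thesis
      by (simp add: algebra_simps)
  qed
  \<comment> \<open>Pairs with a vertex of low degree have used \<open>p\<^sup>2 * var p\<close> of
    the gain \<open>2 * p\<^sup>2 * var p\<close>; the rest of it and the gain \<open>disc p\<close>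
    absorb the two losses with factor \<open>\<beta> * M\<close>.\<close>
  have "\<beta> * M \<le> p\<^sup>2" "\<beta> * M \<le> 1"
    using small2 p power_le_one[of p 2] by (auto simp: M_def)
  then have "\<beta> * M * disc p \<le> 1 * disc p" "\<beta> * M * var p \<le> p\<^sup>2 * var p"
    using disc_nonneg var_nonneg by (intro mult_right_mono; simp)+
  moreover have "E (\<lambda>x. E (\<lambda>y. (cd x y)\<^sup>2)) = p ^ 4 + 2 * p\<^sup>2 * var p + 4 * p ^ 3 * (E d - p) + disc p"
    unfolding E_cd_square[of p] by (simp add: algebra_simps eval_nat_numeral)
  ultimately have "E (\<lambda>x. E (\<lambda>y. (cd x y)\<^sup>2)) + 2 * \<beta> * E (\<lambda>x. l x * q x) - p\<^sup>2 * var p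
      \<ge> p ^ 4 + 4 * p ^ 3 * (E d - p) + 10 * \<beta> * p ^ 3 * (E d - p)"
    using \<beta>lq by linarith
  then have "P * (p ^ 4 + (4 + 10 * \<beta>) * p ^ 3 * (E d - p)) \<le>
      P * (E (\<lambda>x. E (\<lambda>y. (cd x y)\<^sup>2)) + 2 * \<beta> * E (\<lambda>x. l x * q x) - p\<^sup>2 * var p)"
    using P by (intro mult_left_mono) (auto simp: algebra_simps)
  then show ?thesis
    using Q unfolding P_def by (rule order_trans)
qed

end

section \<open>Finding a dense colour with many pentagons\<close>

lemma avg_of_bool:
  assumes "finite V" "X \<subseteq> V"
  shows "avg V (\<lambda>x. of_bool (x \<in> X) * f x) = (\<Sum>x\<in>X. f x) / real (card V)"
proof -
  have "(\<Sum>x\<in>V. of_bool (x \<in> X) * f x) = (\<Sum>x\<in>X. f x)"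
    using assms by (intro sum.mono_neutral_cong_right) auto
  then show ?thesis by (simp add: avg_def)
qed

context kernel
begin

text \<open>The optimal bound is \<open>(E d) ^ 3\<close>, but a crude truncation argument suffices.\<close>

lemma three_edge_walks_ge: "E (\<lambda>y. E (\<lambda>z. d y * u y z * d z)) \<ge> (E d) ^ 3 / 32"
proof -
  \<comment> \<open>A quarter of the mean: the edges meeting a vertex of degree below
    \<open>t\<close> have weight at most \<open>2 * t\<close>, half of the total, so that
    \<open>t\<^sup>2 * (2 * t) = (E d) ^ 3 / 32\<close> remains.\<close>
  define t where "t = E d / 4"
  have t: "0 \<le> t"
    unfolding t_def using d_nonneg by (simp add: avg_nonneg)
  define s :: "'a \<Rightarrow> real" where "s y = of_bool (d y < t)" for y
  have ptw: "d y * u y z * d z \<ge> t\<^sup>2 * (u y z - s y * u y z - s z * u z y)" for y z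
  proof (cases "d y < t \<or> d z < t")
    case True
    then have "u y z - s y * u y z - s z * u z y \<le> 0"
      using nonneg[of y z] sym[of y z] by (auto simp: s_def)
    then have "t\<^sup>2 * (u y z - s y * u y z - s z * u z y) \<le> 0"
      by (intro mult_nonneg_nonpos) auto
    also have "0 \<le> d y * u y z * d z"
      by (intro mult_nonneg_nonneg d_nonneg nonneg)
    finally show ?thesis .
  next
    case False
    then have "t * t \<le> d y * d z"
      using t by (intro mult_mono) auto
    then have "t * t * u y z \<le> d y * d z * u y z"
      by (intro mult_right_mono nonneg)
    then show ?thesis
      using False by (simp add: s_def power2_eq_square mult_ac)
  qed
  have "E (\<lambda>y. s y * d y) \<le> E (\<lambda>y. t)"
    using t by (intro avg_mono) (auto simp: s_def)
  then have s: "E (\<lambda>y. s y * d y) \<le> t"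
    by simp
  have "E (\<lambda>y. E (\<lambda>z. d y * u y z * d z)) \<ge> E (\<lambda>y. E (\<lambda>z. t\<^sup>2 * (u y z - s y * u y z - s z * u z y)))"
    by (intro avg_mono ptw)
  also have "E (\<lambda>y. E (\<lambda>z. t\<^sup>2 * (u y z - s y * u y z - s z * u z y)))
      = t\<^sup>2 * (E d - E (\<lambda>y. s y * d y) - E (\<lambda>y. s y * d y))"
  proof -
    have "E (\<lambda>y. E (\<lambda>z. s z * u z y)) = E (\<lambda>z. s z * d z)"
      by (subst avg_swap) (simp add: avg_linear deg_def)
    then show ?thesis
      by (simp add: avg_linear flip: deg_def)
  qed
  finally have "t\<^sup>2 * (E d - E (\<lambda>y. s y * d y) - E (\<lambda>y. s y * d y))
      \<le> E (\<lambda>y. E (\<lambda>z. d y * u y z * d z))" .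
  moreover have "t\<^sup>2 * (E d - t - t) \<le> t\<^sup>2 * (E d - E (\<lambda>y. s y * d y) - E (\<lambda>y. s y * d y))"
    using s by (intro mult_left_mono) auto
  moreover have "t\<^sup>2 * (E d - t - t) = (E d) ^ 3 / 32"
    by (simp add: t_def eval_nat_numeral)
  ultimately show ?thesis by linarith
qed

text \<open>A three-edge walk inside the neighbourhood of \<open>x\<close> closes up to a pentagon through \<open>x\<close>.\<close>

lemma pentagons_ge_density:
  assumes X: "X \<subseteq> V" and nb: "\<And>y. y \<in> X \<Longrightarrow> u x y = 1"
  shows "((\<Sum>y\<in>X. \<Sum>z\<in>X. u y z) / (real (card V))\<^sup>2) ^ 3 / 32 \<le> c5 x"
proof -
  \<comment> \<open>\<open>v\<close> keeps only the edges inside \<open>X\<close>. Since all of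
    \<open>X\<close> is adjacent to \<open>x\<close>, its degrees bound the codegrees with
    \<open>x\<close> from below.\<close>
  define v where "v y z = of_bool (y \<in> X) * (of_bool (z \<in> X) * u y z)" for y z
  interpret v: kernel V v
    by standard (use fin ne nonneg le1 sym in \<open>auto simp: v_def\<close>)
  have v_le: "v y z \<le> u y z" "v y z \<le> u x y * u y z" "v y z \<le> u x z * u y z" for y z
    using nonneg by (auto simp: v_def nb)
  have cd_ge: "cd x y \<ge> deg V v y" for y
    unfolding codeg_def deg_def using v_le sym[of y] by (intro avg_mono) (simp add: v.sym)
  have cd_ge': "cd y x \<ge> deg V v y" for y
    using cd_ge[of y] cd_sym[of x y] by simp
  have "E (\<lambda>y. E (\<lambda>z. deg V v y * v y z * deg V v z)) \<le> c5 x"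
    unfolding pentagons_def
    by (intro avg_mono mult_mono v_le cd_ge cd_ge' v.nonneg v.d_nonneg cd_nonneg mult_nonneg_nonneg nonneg)
  moreover have "E (deg V v) = (\<Sum>y\<in>X. \<Sum>z\<in>X. u y z) / (real (card V))\<^sup>2"
    unfolding deg_def v_def avg_cmult avg_of_bool[OF fin X]
    by (simp add: power2_eq_square flip: sum_divide_distrib)
  ultimately show ?thesis
    using v.three_edge_walks_ge by simp
qed

end

section \<open>Colourings and the dichotomy between a dense colour and many pentagons\<close>

locale colouring =
  fixes V :: "'a set" and k :: nat and w :: "nat \<Rightarrow> 'a \<Rightarrow> 'a \<Rightarrow> real"
  assumes fin: "finite V" and ne: "V \<noteq> {}"
    and sym: "w i x y = w i y x"
    and zero_one: "w i x y \<in> {0, 1}"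
    and total: "x \<in> V \<Longrightarrow> y \<in> V \<Longrightarrow> (\<Sum>i<k. w i x y) = 1"
begin

lemma nonneg: "0 \<le> w i x y"
  using zero_one[of i x y] by auto

sublocale kernel V "w i" for i
proof
  show "w i x y \<le> 1" for x y
    using zero_one[of i x y] by auto
qed (use fin ne nonneg sym in auto)

end

text \<open>The density \<open>1 / (k - 1/2)\<close> may be replaced by any other value strictly between \<open>1 / k\<close>
  and \<open>1 / (k - 1)\<close>.\<close>

definition rich :: "'a set \<Rightarrow> nat \<Rightarrow> (nat \<Rightarrow> 'a \<Rightarrow> 'a \<Rightarrow> real) \<Rightarrow> real \<Rightarrow> nat \<Rightarrow> 'a set \<Rightarrow> bool" where
  "rich V k w \<gamma> j X \<longleftrightarrow> j < k \<and> X \<subseteq> V \<and> \<gamma> * card V \<le> card X \<and>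
     (real (card X))\<^sup>2 / (real k - 1/2) \<le> (\<Sum>x\<in>{x\<in>X. \<gamma> \<le> pentagons V (w j) x}. \<Sum>y\<in>X. w j x y)"

lemma (in colouring) rich_mono:
  assumes "rich V k w \<gamma> j X" "\<delta> \<le> \<gamma>"
  shows "rich V k w \<delta> j X"
proof -
  have "X \<subseteq> V"
    using assms(1) by (simp add: rich_def)
  then have "(\<Sum>x\<in>{x\<in>X. \<gamma> \<le> pentagons V (w j) x}. \<Sum>y\<in>X. w j x y)
      \<le> (\<Sum>x\<in>{x\<in>X. \<delta> \<le> pentagons V (w j) x}. \<Sum>y\<in>X. w j x y)"
    using assms(2) fin nonneg by (intro sum_mono2) (auto intro: sum_nonneg finite_subset)
  moreover have "\<delta> * card V \<le> \<gamma> * card V"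
    using assms(2) by (simp add: mult_right_mono)
  ultimately show ?thesis
    using assms(1) unfolding rich_def by (meson order_trans)
qed

lemma cube_le_imp_le:
  fixes x y :: real
  shows "x ^ 3 \<le> y ^ 3 \<Longrightarrow> 0 \<le> y \<Longrightarrow> x \<le> y"
  by (rule ccontr) (use power_strict_mono[of y x 3] in auto)

text \<open>The gap between \<open>1 / (k - 1)\<close> and \<open>1 / (k - 1/2)\<close> is of order
  \<open>1 / k\<^sup>2\<close> and leaves room for two losses of \<open>\<epsilon>\<close>: one from
  the sparse colours, one from vertices of small degree.\<close>

lemma density_gap:
  fixes k :: nat
  assumes "k \<ge> 2"
  defines "\<epsilon> \<equiv> 1 / (4 * (real k)\<^sup>2)"
  shows "1 / (real k - 1/2) \<le> (1 - \<epsilon>) / (real k - 1) - \<epsilon>"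
proof -
  define x where "x = real k"
  have x: "x \<ge> 2"
    using assms by (simp add: x_def)
  have "\<epsilon> * x / (x - 1) + 1 / (x - 1/2) \<le> 1 / (x - 1)"
  proof -
    have "\<epsilon> * x * (x - 1/2) + (x - 1) \<le> x - 1/2"
    proof -
      have "\<epsilon> * x * (x - 1/2) \<le> \<epsilon> * x * x"
        using x by (intro mult_left_mono) (auto simp: \<epsilon>_def)
      also have "\<dots> = 1 / 4"
        using x by (simp add: \<epsilon>_def power2_eq_square flip: x_def)
      finally show ?thesis by simp
    qed
    then have "\<epsilon> * x / (x - 1) + 1 / (x - 1/2) = (\<epsilon> * x * (x - 1/2) + (x - 1)) / ((x - 1) * (x - 1/2))"
      using x by (simp add: add_frac_eq)
    also have "\<dots> \<le> (x - 1/2) / ((x - 1) * (x - 1/2))"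
      using x \<open>_ \<le> x - 1/2\<close> by (intro divide_right_mono) auto
    also have "\<dots> = 1 / (x - 1)"
      using x by simp
    finally show ?thesis .
  qed
  moreover have "(1 - \<epsilon>) / (x - 1) - \<epsilon> = 1 / (x - 1) - \<epsilon> * x / (x - 1)"
    using x by (simp add: field_simps)
  ultimately show ?thesis
    by (simp add: x_def)
qed

text \<open>Induction on the number of colours that are not yet sparse on the current set: either some
  colour wins there, or we pass to a neighbourhood on which one more colour is sparse. The gain
  over \<open>1 / k\<close> comes from having at most \<open>k - 1\<close> colours left.\<close>

lemma rich_if_sparse_colours:
  fixes k r :: nat and \<mu> :: real
  assumes k: "k \<ge> 2" and "r < k" and "\<mu> > 0"
  shows "\<exists>\<gamma>>0. \<forall>(V :: 'a set) w R X. colouring V k w \<longrightarrow> R \<subseteq> {..<k} \<longrightarrow> card R = r \<longrightarrow>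
     X \<subseteq> V \<longrightarrow> \<mu> * card V \<le> card X \<longrightarrow>
     (\<forall>i\<in>{..<k} - R. (\<Sum>x\<in>X. \<Sum>y\<in>X. w i x y) \<le> \<gamma> * (real (card V))\<^sup>2) \<longrightarrow>
     (\<exists>j X'. rich V k w \<gamma> j X')"
  using assms(2,3)
proof (induction r arbitrary: \<mu>)
  case 0
  \<comment> \<open>The \<open>k\<close> sparse colours then cover at most half of
    \<open>(\<mu> * card V)\<^sup>2\<close>, although together they must cover all pairs in
    \<open>X\<close>.\<close>
  define \<gamma> where "\<gamma> = \<mu>\<^sup>2 / (2 * k)"
  have "False" if "colouring V k w" and X: "X \<subseteq> V" "\<mu> * card V \<le> card X"
    and sparse: "\<forall>i<k. (\<Sum>x\<in>X. \<Sum>y\<in>X. w i x y) \<le> \<gamma> * (real (card V))\<^sup>2" for V :: "'a set" and w X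
  proof -
    interpret colouring V k w by fact
    have N: "0 < real (card V)"
      using fin ne by (simp add: card_gt_0_iff)
    have "(\<Sum>i<k. \<Sum>x\<in>X. \<Sum>y\<in>X. w i x y) = (\<Sum>x\<in>X. \<Sum>y\<in>X. \<Sum>i<k. w i x y)"
      by (subst sum.swap) (intro sum.cong refl sum.swap)
    also have "\<dots> = (\<Sum>x\<in>X. \<Sum>y\<in>X. 1)"
      using X total by (intro sum.cong refl) auto
    finally have "(real (card X))\<^sup>2 = (\<Sum>i<k. \<Sum>x\<in>X. \<Sum>y\<in>X. w i x y)"
      by (simp add: power2_eq_square)
    also have "\<dots> \<le> (\<Sum>i<k. \<gamma> * (real (card V))\<^sup>2)"
      using sparse by (intro sum_mono) auto
    also have "\<dots> = (\<mu> * card V)\<^sup>2 / 2"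
      using k by (simp add: \<gamma>_def power_mult_distrib)
    also have "\<dots> < (\<mu> * card V)\<^sup>2"
      using N 0 by simp
    also have "\<dots> \<le> (real (card X))\<^sup>2"
      using X(2) N 0 by (intro power_mono) auto
    finally show False by simp
  qed
  moreover have "\<gamma> > 0"
    using 0 k by (simp add: \<gamma>_def)
  moreover have "R = {}" if "R \<subseteq> {..<k}" "card R = 0" for R
    using that by (metis card_0_eq finite_lessThan finite_subset)
  ultimately show ?case
    by (intro exI[of _ \<gamma>]) (metis DiffI emptyE lessThan_iff)
next
  case (Suc r)
  define \<epsilon> where "\<epsilon> = 1 / (4 * (real k)\<^sup>2)"
  have \<epsilon>: "0 < \<epsilon>" "\<epsilon> < 1"
  proof -
    have "1 < 4 * (real k)\<^sup>2"
      using k power_mono[of 2 "real k" 2] by simp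
    then show "0 < \<epsilon>" "\<epsilon> < 1"
      using k by (auto simp: \<epsilon>_def divide_less_eq)
  qed
  \<comment> \<open>The induction hypothesis will be applied to a neighbourhood inside
    \<open>X\<close>, of size at least \<open>\<epsilon> * \<mu> * card V\<close>.\<close>
  obtain \<gamma>1 where \<gamma>1: "\<gamma>1 > 0" and IH: "\<And>(V :: 'a set) w R X. colouring V k w \<Longrightarrow> R \<subseteq> {..<k} \<Longrightarrow>
     card R = r \<Longrightarrow> X \<subseteq> V \<Longrightarrow> \<epsilon> * \<mu> * card V \<le> card X \<Longrightarrow>
     (\<forall>i\<in>{..<k} - R. (\<Sum>x\<in>X. \<Sum>y\<in>X. w i x y) \<le> \<gamma>1 * (real (card V))\<^sup>2) \<Longrightarrow>
     (\<exists>j X'. rich V k w \<gamma>1 j X')"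
    using Suc.IH[of "\<epsilon> * \<mu>"] Suc.prems \<epsilon> by auto
  \<comment> \<open>In order, the bounds allow passing to the induction hypothesis, keep
    \<open>X\<close> itself large enough, limit the sparse colours to a share
    \<open>\<epsilon>\<close> of the pairs, and turn a pentagon density below
    \<open>\<gamma>\<close> into edge density at most \<open>\<gamma>1\<close>.\<close>
  define \<gamma> where "\<gamma> = min (min \<gamma>1 \<mu>) (min (\<epsilon> * \<mu>\<^sup>2 / k) (\<gamma>1 ^ 3 / 32))"
  have \<gamma>: "\<gamma> \<le> \<gamma>1" "\<gamma> \<le> \<mu>" "\<gamma> \<le> \<epsilon> * \<mu>\<^sup>2 / k" "\<gamma> \<le> \<gamma>1 ^ 3 / 32"
    unfolding \<gamma>_def by (simp_all only: min.coboundedI1 min.coboundedI2 min.cobounded1 min.cobounded2)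
  have \<gamma>_pos: "0 < \<gamma>"
    using \<gamma>1 \<epsilon> Suc.prems k by (simp add: \<gamma>_def)
  have "\<exists>j X'. rich V k w \<gamma> j X'" if col: "colouring V k w" and R: "R \<subseteq> {..<k}" "card R = Suc r"
    and X: "X \<subseteq> V" "\<mu> * card V \<le> card X"
    and sparse: "\<forall>i\<in>{..<k} - R. (\<Sum>x\<in>X. \<Sum>y\<in>X. w i x y) \<le> \<gamma> * (real (card V))\<^sup>2" for V :: "'a set" and w R X
  proof -
    interpret colouring V k w by fact
    define e where "e i = (\<Sum>x\<in>X. \<Sum>y\<in>X. w i x y)" for i
    define N where "N = real (card V)"
    define n where "n = real (card X)"
    have finX: "finite X"
      using X fin by (auto intro: finite_subset)
    have N: "0 < N"
      using fin ne by (simp add: N_def card_gt_0_iff)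
    have "0 < \<mu> * N"
      using N Suc.prems by simp
    then have n: "0 < n" "\<mu> * N \<le> n"
      using X by (auto simp: n_def N_def)
    have finR: "finite R"
      using R by (auto intro: finite_subset)
    have "(\<Sum>i<k. e i) = (\<Sum>x\<in>X. \<Sum>y\<in>X. \<Sum>i<k. w i x y)"
      unfolding e_def by (subst sum.swap) (intro sum.cong refl sum.swap)
    also have "\<dots> = (\<Sum>x\<in>X. \<Sum>y\<in>X. 1)"
      using X total by (intro sum.cong refl) auto
    finally have "n\<^sup>2 = (\<Sum>i<k. e i)"
      by (simp add: power2_eq_square n_def)
    also have "\<dots> = (\<Sum>i\<in>{..<k} - R. e i) + (\<Sum>i\<in>R. e i)"
      using R by (intro sum.subset_diff) auto
    also have "(\<Sum>i\<in>{..<k} - R. e i) \<le> (\<Sum>i\<in>{..<k} - R. \<gamma> * N\<^sup>2)"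
      using sparse by (intro sum_mono) (auto simp: e_def N_def)
    also have "\<dots> \<le> (\<Sum>i<k. \<gamma> * N\<^sup>2)"
      using \<gamma>_pos by (intro sum_mono2) auto
    also have "\<dots> \<le> \<epsilon> * (\<mu> * N)\<^sup>2"
      using \<gamma>(3) k N by (simp add: field_simps power_mult_distrib)
    also have "\<dots> \<le> \<epsilon> * n\<^sup>2"
      using n \<open>0 < \<mu> * N\<close> \<epsilon> by (intro mult_left_mono power_mono) auto
    finally have eR: "(1 - \<epsilon>) * n\<^sup>2 \<le> (\<Sum>i\<in>R. e i)"
      by (simp add: algebra_simps)
    \<comment> \<open>Pigeonhole among the at most \<open>k - 1\<close> colours in
      \<open>R\<close>.\<close>
    obtain j where j: "j \<in> R" and ej: "(1 - \<epsilon>) * n\<^sup>2 / (real k - 1) \<le> e j"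
    proof (rule ccontr)
      assume "\<not> thesis"
      then have "\<forall>i\<in>R. e i < (1 - \<epsilon>) * n\<^sup>2 / (real k - 1)"
        using that by force
      then have "(\<Sum>i\<in>R. e i) < (\<Sum>i\<in>R. (1 - \<epsilon>) * n\<^sup>2 / (real k - 1))"
        using R finR by (intro sum_strict_mono) auto
      also have "\<dots> = real (Suc r) * ((1 - \<epsilon>) * n\<^sup>2 / (real k - 1))"
        using R by simp
      also have "\<dots> \<le> (real k - 1) * ((1 - \<epsilon>) * n\<^sup>2 / (real k - 1))"
        using Suc.prems \<epsilon> k by (intro mult_right_mono) auto
      also have "\<dots> = (1 - \<epsilon>) * n\<^sup>2"
        using k by simp
      finally show False
        using eR by simp
    qed
    show ?thesis
    \<comment> \<open>Either a vertex of large degree in colour \<open>j\<close> has few pentagons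
      and its neighbourhood serves the induction, or the vertices with few pentagons all have small
      degree and can be discarded.\<close>
    proof (cases "\<exists>x\<in>X. pentagons V (w j) x < \<gamma> \<and> \<epsilon> * n \<le> (\<Sum>y\<in>X. w j x y)")
      case True
      then obtain x where x: "x \<in> X" "pentagons V (w j) x < \<gamma>" "\<epsilon> * n \<le> (\<Sum>y\<in>X. w j x y)"
        by auto
      define X1 where "X1 = {y \<in> X. w j x y = 1}"
      have X1: "X1 \<subseteq> X" "X1 \<subseteq> V"
        using X by (auto simp: X1_def)
      have sub: "(\<Sum>x\<in>X1. \<Sum>y\<in>X1. w i x y) \<le> e i" for i
      proof -
        have "(\<Sum>x\<in>X1. \<Sum>y\<in>X1. w i x y) \<le> (\<Sum>x\<in>X1. \<Sum>y\<in>X. w i x y)"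
          using X1 finX nonneg by (intro sum_mono sum_mono2) auto
        also have "\<dots> \<le> e i"
          unfolding e_def using X1 finX nonneg by (intro sum_mono2) (auto intro: sum_nonneg)
        finally show ?thesis .
      qed
      have "(\<Sum>y\<in>X. w j x y) = (\<Sum>y\<in>X1. w j x y)"
        using finX zero_one by (intro sum.mono_neutral_right) (auto simp: X1_def)
      also have "\<dots> = (\<Sum>y\<in>X1. 1)"
        by (intro sum.cong) (auto simp: X1_def)
      finally have "\<epsilon> * n \<le> real (card X1)"
        using x by simp
      moreover have "\<epsilon> * (\<mu> * N) \<le> \<epsilon> * n"
        using n \<epsilon> by (intro mult_left_mono) auto
      ultimately have cX1: "\<epsilon> * \<mu> * card V \<le> card X1"
        by (simp add: N_def)
      \<comment> \<open>On \<open>X1\<close> colour \<open>j\<close> is sparse because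
        \<open>x\<close> has few pentagons; colours outside \<open>R\<close> stay sparse on the
        subset.\<close>
      have "(\<Sum>x\<in>X1. \<Sum>y\<in>X1. w i x y) \<le> \<gamma>1 * (real (card V))\<^sup>2" if i: "i \<in> {..<k} - (R - {j})" for i
      proof (cases "i = j")
        case False
        then have "e i \<le> \<gamma> * N\<^sup>2"
          using i sparse by (auto simp: e_def N_def)
        also have "\<dots> \<le> \<gamma>1 * N\<^sup>2"
          using \<gamma> by (intro mult_right_mono) auto
        finally show ?thesis
          using sub[of i] by (simp add: N_def)
      next
        case True
        have "((\<Sum>x\<in>X1. \<Sum>y\<in>X1. w j x y) / N\<^sup>2) ^ 3 / 32 \<le> pentagons V (w j) x"
          unfolding N_def using X1 by (intro pentagons_ge_density) (auto simp: X1_def)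
        also have "\<dots> \<le> \<gamma>1 ^ 3 / 32"
          using x \<gamma> by simp
        finally have "((\<Sum>x\<in>X1. \<Sum>y\<in>X1. w j x y) / N\<^sup>2) ^ 3 \<le> \<gamma>1 ^ 3"
          by simp
        then have "(\<Sum>x\<in>X1. \<Sum>y\<in>X1. w j x y) / N\<^sup>2 \<le> \<gamma>1"
          by (rule cube_le_imp_le) (use \<gamma>1 in simp)
        then show ?thesis
          using True N by (simp add: N_def field_simps)
      qed
      then have "\<exists>j X'. rich V k w \<gamma>1 j X'"
        using R j finR X1 cX1 by (intro IH[OF col, of "R - {j}" X1]) auto
      then show ?thesis
        using rich_mono \<gamma>(1) by blast
    next
      case False
      define Y where "Y = {x \<in> X. \<gamma> \<le> pentagons V (w j) x}"
      have "e j = (\<Sum>x\<in>X - Y. \<Sum>y\<in>X. w j x y) + (\<Sum>x\<in>Y. \<Sum>y\<in>X. w j x y)"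
        unfolding e_def using finX by (intro sum.subset_diff) (auto simp: Y_def)
      also have "(\<Sum>x\<in>X - Y. \<Sum>y\<in>X. w j x y) \<le> (\<Sum>x\<in>X - Y. \<epsilon> * n)"
        using False by (intro sum_mono) (auto simp: Y_def not_le intro: less_imp_le)
      also have "\<dots> \<le> (\<Sum>x\<in>X. \<epsilon> * n)"
        using finX \<epsilon> n by (intro sum_mono2) auto
      also have "\<dots> = \<epsilon> * n\<^sup>2"
        by (simp add: n_def power2_eq_square)
      finally have "((1 - \<epsilon>) / (real k - 1) - \<epsilon>) * n\<^sup>2 \<le> (\<Sum>x\<in>Y. \<Sum>y\<in>X. w j x y)"
        using ej by (simp add: algebra_simps)
      moreover have "1 / (real k - 1/2) * n\<^sup>2 \<le> ((1 - \<epsilon>) / (real k - 1) - \<epsilon>) * n\<^sup>2"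
        unfolding \<epsilon>_def using density_gap[OF k] by (intro mult_right_mono) auto
      moreover have "\<gamma> * N \<le> n"
        using \<gamma>(2) n N by (meson less_imp_le mult_right_mono order_trans)
      ultimately have "rich V k w \<gamma> j X"
        using R j X unfolding rich_def by (auto simp: Y_def n_def N_def)
      then show ?thesis by blast
    qed
  qed
  then show ?case
    using \<gamma>_pos by blast
qed

text \<open>A vertex violating the second alternative has a neighbourhood of linear size on which
  its colour is sparse. This starts the preceding induction with the other \<open>k - 1\<close>
  colours.\<close>

lemma rich_or_many_pentagons:
  fixes k :: nat and \<epsilon> :: real
  assumes k: "k \<ge> 2" and \<epsilon>: "\<epsilon> > 0"
  shows "\<exists>\<gamma>>0. \<forall>(V :: 'a set) w. colouring V k w \<longrightarrow> (\<exists>j X. rich V k w \<gamma> j X) \<or>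
     (\<forall>i<k. \<forall>x\<in>V. deg V (w i) x < \<epsilon> \<or> \<gamma> \<le> pentagons V (w i) x)"
proof -
  have "k - 1 < k"
    using k by simp
  obtain \<gamma>1 where \<gamma>1: "\<gamma>1 > 0" and *: "\<And>(V :: 'a set) w R X. colouring V k w \<Longrightarrow> R \<subseteq> {..<k} \<Longrightarrow>
     card R = k - 1 \<Longrightarrow> X \<subseteq> V \<Longrightarrow> \<epsilon> * card V \<le> card X \<Longrightarrow>
     (\<forall>i\<in>{..<k} - R. (\<Sum>x\<in>X. \<Sum>y\<in>X. w i x y) \<le> \<gamma>1 * (real (card V))\<^sup>2) \<Longrightarrow>
     (\<exists>j X'. rich V k w \<gamma>1 j X')"
    using rich_if_sparse_colours[OF k \<open>k - 1 < k\<close> \<epsilon>, where ?'a = 'a] by auto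
  define \<gamma> where "\<gamma> = min \<gamma>1 (\<gamma>1 ^ 3 / 32)"
  have \<gamma>: "0 < \<gamma>" "\<gamma> \<le> \<gamma>1" "\<gamma> \<le> \<gamma>1 ^ 3 / 32"
    unfolding \<gamma>_def using \<gamma>1 by (simp, simp_all only: min.cobounded1 min.cobounded2)
  have "\<exists>j X. rich V k w \<gamma> j X" if col: "colouring V k w" and i: "i < k" and x: "x \<in> V"
    and d: "\<epsilon> \<le> deg V (w i) x" and c: "pentagons V (w i) x < \<gamma>" for V :: "'a set" and w i x
  proof -
    interpret colouring V k w by fact
    define N where "N = real (card V)"
    have N: "0 < N"
      using fin ne by (simp add: N_def card_gt_0_iff)
    define X where "X = {y \<in> V. w i x y = 1}"
    have "(\<Sum>y\<in>V. w i x y) = (\<Sum>y\<in>X. w i x y)"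
      using fin zero_one by (intro sum.mono_neutral_right) (auto simp: X_def)
    also have "\<dots> = (\<Sum>y\<in>X. 1)"
      by (intro sum.cong) (auto simp: X_def)
    finally have cX: "\<epsilon> * card V \<le> card X"
      using d N by (simp add: deg_def avg_def N_def field_simps)
    have "((\<Sum>x\<in>X. \<Sum>y\<in>X. w i x y) / N\<^sup>2) ^ 3 / 32 \<le> pentagons V (w i) x"
      unfolding N_def by (intro pentagons_ge_density) (auto simp: X_def)
    also have "\<dots> \<le> \<gamma>1 ^ 3 / 32"
      using c \<gamma> by simp
    finally have "((\<Sum>x\<in>X. \<Sum>y\<in>X. w i x y) / N\<^sup>2) ^ 3 \<le> \<gamma>1 ^ 3"
      by simp
    then have "(\<Sum>x\<in>X. \<Sum>y\<in>X. w i x y) / N\<^sup>2 \<le> \<gamma>1"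
      by (rule cube_le_imp_le) (use \<gamma>1 in simp)
    then have "(\<Sum>x\<in>X. \<Sum>y\<in>X. w i x y) \<le> \<gamma>1 * (real (card V))\<^sup>2"
      using N by (simp add: N_def field_simps)
    then have "\<exists>j X'. rich V k w \<gamma>1 j X'"
      using cX i by (intro *[OF col, of "{..<k} - {i}" X]) (auto simp: X_def)
    then show ?thesis
      using rich_mono \<gamma>(2) by blast
  qed
  then show ?thesis
    using \<gamma>(1) by (intro exI[of _ \<gamma>]) (meson not_le)
qed

section \<open>Weighted complete bipartite graphs\<close>

context kernel
begin

text \<open>Up to normalisation, \<open>book n\<close> is the density of \<open>K_{2n,2n}\<close> in which every vertex \<open>x\<close> of
  one part has weight \<open>sqrt (c5 x)\<close>.\<close>

definition book :: "nat \<Rightarrow> real" where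
  "book n = (\<Sum>y\<in>{..<2 * n} \<rightarrow>\<^sub>E V. (\<Sum>x\<in>V. sqrt (c5 x) * (\<Prod>j<2 * n. u x (y j))) ^ (2 * n))"

lemma card_pos: "0 < real (card V)"
  using fin ne by (simp add: card_gt_0_iff)

lemma book_term_nonneg: "0 \<le> (\<Sum>x\<in>V. sqrt (c5 x) * (\<Prod>j<2 * n. u x (y j)))"
  by (intro sum_nonneg mult_nonneg_nonneg prod_nonneg) (auto simp: c5_nonneg nonneg)

text \<open>Squaring the inner sum brings in pairs \<open>x\<close>, \<open>z\<close> and powers of
  their codegree. Jensen's inequality with exponent \<open>n\<close> is then applied over these
  pairs and once more over the tuples \<open>y\<close>.\<close>

lemma book_ge_weighted_C4:
  assumes n: "n \<ge> 1"
  shows "book n \<ge> real (card V) ^ (4 * n) *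
    (E (\<lambda>x. E (\<lambda>y. c5 x powr (1 / (2 * n)) * c5 y powr (1 / (2 * n)) * (cd x y)\<^sup>2))) ^ n\<^sup>2"
proof -
  define N where "N = real (card V)"
  have N: "0 < N"
    unfolding N_def by (rule card_pos)
  define Y where "Y = ({..<2 * n} \<rightarrow>\<^sub>E V)"
  have finY: "finite Y"
    unfolding Y_def using fin by (intro finite_PiE) auto
  have cardY: "real (card Y) = N ^ (2 * n)"
    using fin by (simp add: Y_def card_PiE N_def)
  define G where "G y = (\<Sum>x\<in>V. sqrt (c5 x) * (\<Prod>j<2 * n. u x (y j)))" for y
  define f where "f x z = c5 x powr (1 / (2 * n)) * c5 z powr (1 / (2 * n)) * (cd x z)\<^sup>2" for x z
  define Q where "Q = E (\<lambda>x. E (f x))"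
  have f_nonneg: "0 \<le> f x z" for x z
    by (simp add: f_def)
  obtain n' where n': "n = Suc n'"
    using n by (cases n) auto
  \<comment> \<open>The exponent \<open>1 / (2 * n)\<close> makes the \<open>n\<close>-th power
    restore the square-root weight; for \<open>c5 x = 0\<close> both sides are 0.\<close>
  have "(c5 x powr (1 / (2 * n))) ^ n = sqrt (c5 x)" for x
    using n c5_nonneg[of x] by (cases "c5 x = 0") (auto simp: powr_half_sqrt powr_powr simp flip: powr_realpow)
  then have f_power: "f x z ^ n = sqrt (c5 x) * sqrt (c5 z) * cd x z ^ (2 * n)" for x z
    by (simp add: f_def power_mult_distrib power_mult)
  \<comment> \<open>The coordinates of \<open>y\<close> are independent, so the sum over tuples
    factors into \<open>2 * n\<close> equal codegree sums.\<close>
  have walks: "(\<Sum>y\<in>Y. \<Prod>j<2 * n. u x (y j) * u (y j) z) = (N * cd x z) ^ (2 * n)" for x z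
    unfolding Y_def using fin N
    by (subst prod_sum_PiE[symmetric]) (auto simp: codeg_def avg_def N_def)
  have "(\<Sum>y\<in>Y. (G y)\<^sup>2) =
      (\<Sum>y\<in>Y. \<Sum>x\<in>V. \<Sum>z\<in>V. sqrt (c5 x) * sqrt (c5 z) * (\<Prod>j<2 * n. u x (y j) * u (y j) z))"
    by (simp add: G_def power2_eq_square sum_product prod.distrib mult_ac sym[of _ "_ _"])
  also have "\<dots> = (\<Sum>x\<in>V. \<Sum>z\<in>V. sqrt (c5 x) * sqrt (c5 z) * (\<Sum>y\<in>Y. \<Prod>j<2 * n. u x (y j) * u (y j) z))"
    by (subst sum.swap) (simp add: sum_distrib_left sum.swap[of _ V Y])
  also have "\<dots> = (\<Sum>x\<in>V. \<Sum>z\<in>V. N ^ (2 * n) * f x z ^ n)"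
    unfolding walks by (simp add: f_power power_mult_distrib mult_ac)
  also have "\<dots> = N ^ (2 * n) * N\<^sup>2 * E (\<lambda>x. E (\<lambda>z. f x z ^ n))"
    using N by (simp add: avg_def N_def power2_eq_square flip: sum_divide_distrib sum_distrib_left)
  finally have G2: "(\<Sum>y\<in>Y. (G y)\<^sup>2) = N ^ (2 * n) * N\<^sup>2 * E (\<lambda>x. E (\<lambda>z. f x z ^ n))" .
  have "N ^ (2 * n) * N\<^sup>2 * Q ^ n \<le> (\<Sum>y\<in>Y. (G y)\<^sup>2)"
    unfolding G2
  proof (intro mult_left_mono)
    have "Q ^ n \<le> E (\<lambda>x. (E (f x)) ^ n)"
      unfolding Q_def n' by (intro avg_power_le fin avg_nonneg f_nonneg)
    also have "\<dots> \<le> E (\<lambda>x. E (\<lambda>z. f x z ^ n))"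
      unfolding n' by (intro avg_mono avg_power_le fin f_nonneg)
    finally show "Q ^ n \<le> E (\<lambda>x. E (\<lambda>z. f x z ^ n))" .
  qed (use N in auto)
  then have "N ^ (2 * n + 2) * Q ^ n \<le> (\<Sum>y\<in>Y. (G y)\<^sup>2)"
    by (simp only: power_add)
  moreover have "0 \<le> Q"
    unfolding Q_def by (intro avg_nonneg f_nonneg)
  ultimately have "(N ^ (2 * n + 2) * Q ^ n) ^ n \<le> (\<Sum>y\<in>Y. (G y)\<^sup>2) ^ n"
    using N by (intro power_mono) auto
  also have "\<dots> \<le> real (card Y) ^ n' * (\<Sum>y\<in>Y. ((G y)\<^sup>2) ^ n)"
    unfolding n' by (intro sum_power_le finY) simp
  also have "(\<Sum>y\<in>Y. ((G y)\<^sup>2) ^ n) = book n"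
    by (simp add: book_def G_def Y_def power_mult)
  finally have "(N ^ (2 * n + 2) * Q ^ n) ^ n \<le> N ^ (2 * n * n') * book n"
    by (simp add: cardY power_mult)
  \<comment> \<open>\<open>N ^ (2 * n * n')\<close> is the factor \<open>card Y ^ n'\<close> from
    the power mean inequality; it cancels.\<close>
  moreover have "(N ^ (2 * n + 2) * Q ^ n) ^ n = N ^ (2 * n * n') * (N ^ (4 * n) * Q ^ n\<^sup>2)"
  proof -
    have "(2 * n + 2) * n = 2 * n * n' + 4 * n"
      by (simp add: n' algebra_simps)
    then have "N ^ ((2 * n + 2) * n) = N ^ (2 * n * n') * N ^ (4 * n)"
      by (simp only: power_add)
    then show ?thesis
      by (simp only: power_mult power_mult_distrib power2_eq_square mult.assoc)
  qed
  ultimately show ?thesis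
    using N by (simp add: Q_def f_def[abs_def] N_def)
qed

text \<open>Discarding vertices with few pentagons and tuples leaving \<open>X\<close> gives a
  bipartite count with weights at least \<open>sqrt \<gamma>\<close>. Two power mean steps, over
  \<open>x\<close> and over the tuples, bound it from below.\<close>

lemma book_ge_dense_pair:
  assumes n: "n \<ge> 1" and X: "X \<subseteq> V" "X \<noteq> {}" and \<gamma>: "0 \<le> \<gamma>" and \<theta>: "0 \<le> \<theta>"
    and dense: "\<theta> * (real (card X))\<^sup>2 \<le> (\<Sum>x\<in>{x\<in>X. \<gamma> \<le> c5 x}. \<Sum>y\<in>X. u x y)"
  shows "book n \<ge> \<gamma> ^ n * \<theta> ^ (4 * n\<^sup>2) * real (card X) ^ (4 * n)"
proof -
  define a where "a = real (card X)"
  define Y where "Y = {x\<in>X. \<gamma> \<le> c5 x}"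
  define Z where "Z = ({..<2 * n} \<rightarrow>\<^sub>E X)"
  define G where "G y = (\<Sum>x\<in>V. sqrt (c5 x) * (\<Prod>j<2 * n. u x (y j)))" for y
  define D where "D x = (\<Sum>y\<in>X. u x y)" for x
  define T where "T = (\<Sum>y\<in>Z. G y)"
  have finX: "finite X"
    using X fin by (auto intro: finite_subset)
  have a: "0 < a"
    using X finX by (simp add: a_def card_gt_0_iff)
  have Y: "Y \<subseteq> X" "Y \<subseteq> V" "finite Y"
    using X finX by (auto simp: Y_def)
  have finZ: "finite Z"
    unfolding Z_def using finX by (intro finite_PiE) auto
  have cardZ: "real (card Z) = a ^ (2 * n)"
    using finX by (simp add: Z_def card_PiE a_def)
  have D: "0 \<le> D x" for x
    unfolding D_def by (intro sum_nonneg nonneg)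
  obtain m where m: "2 * n = Suc m"
    using n by (cases "2 * n") auto
  have T: "sqrt \<gamma> * (\<Sum>x\<in>Y. D x ^ (2 * n)) \<le> T"
  proof -
    have "sqrt \<gamma> * (\<Sum>x\<in>Y. D x ^ (2 * n)) \<le> (\<Sum>x\<in>Y. sqrt (c5 x) * D x ^ (2 * n))"
      unfolding sum_distrib_left using D by (intro sum_mono mult_right_mono) (auto simp: Y_def)
    also have "\<dots> \<le> (\<Sum>x\<in>V. sqrt (c5 x) * D x ^ (2 * n))"
      using Y fin D c5_nonneg by (intro sum_mono2) auto
    also have "\<dots> = (\<Sum>x\<in>V. sqrt (c5 x) * (\<Sum>y\<in>Z. \<Prod>j<2 * n. u x (y j)))"
      unfolding Z_def D_def using finX by (subst prod_sum_PiE[symmetric]) auto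
    also have "\<dots> = T"
      unfolding T_def G_def by (subst sum.swap) (simp add: sum_distrib_left)
    finally show ?thesis .
  qed
  have "(\<theta> * a\<^sup>2) ^ (2 * n) \<le> (\<Sum>x\<in>Y. D x) ^ (2 * n)"
    using dense \<theta> by (intro power_mono) (auto simp: a_def Y_def D_def)
  also have "\<dots> \<le> real (card Y) ^ m * (\<Sum>x\<in>Y. D x ^ (2 * n))"
    unfolding m by (intro sum_power_le Y D)
  also have "\<dots> \<le> a ^ m * (\<Sum>x\<in>Y. D x ^ (2 * n))"
    unfolding a_def using Y finX D
    by (intro mult_right_mono power_mono sum_nonneg) (auto intro: card_mono)
  finally have "sqrt \<gamma> * (\<theta> * a\<^sup>2) ^ (2 * n) \<le> sqrt \<gamma> * (a ^ m * (\<Sum>x\<in>Y. D x ^ (2 * n)))"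
    using \<gamma> by (intro mult_left_mono) auto
  also have "\<dots> \<le> a ^ m * T"
    using mult_left_mono[OF T, of "a ^ m"] a by (simp add: mult_ac)
  finally have "(sqrt \<gamma> * (\<theta> * a\<^sup>2) ^ (2 * n)) ^ (2 * n) \<le> (a ^ m * T) ^ (2 * n)"
    using \<gamma> \<theta> by (intro power_mono) auto
  also have "\<dots> = a ^ (m * (2 * n)) * T ^ (2 * n)"
    by (simp add: power_mult_distrib flip: power_mult)
  also have "T ^ (2 * n) \<le> real (card Z) ^ m * (\<Sum>y\<in>Z. G y ^ (2 * n))"
    unfolding T_def m using book_term_nonneg[where n = n] by (intro sum_power_le finZ) (auto simp: G_def m)
  also have "(\<Sum>y\<in>Z. G y ^ (2 * n)) \<le> book n"
    unfolding book_def G_def using X fin book_term_nonneg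
    by (intro sum_mono2 finite_PiE) (auto simp: Z_def)
  finally have "(sqrt \<gamma> * (\<theta> * a\<^sup>2) ^ (2 * n)) ^ (2 * n) \<le> a ^ (m * (2 * n)) * (a ^ (m * (2 * n)) * book n)"
    using a by (simp add: cardZ mult_ac flip: power_mult)
  moreover have "(sqrt \<gamma> * (\<theta> * a\<^sup>2) ^ (2 * n)) ^ (2 * n) =
      a ^ (m * (2 * n)) * (a ^ (m * (2 * n)) * (\<gamma> ^ n * \<theta> ^ (4 * n\<^sup>2) * a ^ (4 * n)))"
  proof -
    have "sqrt \<gamma> ^ (2 * n) = \<gamma> ^ n"
      using \<gamma> by (simp add: power_mult)
    moreover have "a ^ (2 * (2 * n) * (2 * n)) = a ^ (m * (2 * n)) * (a ^ (m * (2 * n)) * a ^ (4 * n))"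
    proof -
      have "2 * (2 * n) * (2 * n) = m * (2 * n) + (m * (2 * n) + 4 * n)"
        using m by (simp add: algebra_simps)
      then show ?thesis
        by (simp only: power_add)
    qed
    moreover have "2 * n * (2 * n) = 4 * n\<^sup>2"
      by (simp add: power2_eq_square)
    ultimately show ?thesis
      by (simp only: power_mult_distrib mult_ac flip: power_mult)
  qed
  ultimately show ?thesis
    using a by (simp add: a_def)
qed

end

section \<open>The main inequality\<close>

lemma total_book_ge:
  fixes k :: nat
  assumes k: "k \<ge> 2"
  shows "\<exists>n\<^sub>0\<ge>1. \<forall>n\<ge>n\<^sub>0. \<forall>(V :: 'a set) w. colouring V k w \<longrightarrow>
    (\<Sum>i<k. kernel.book V (w i) n) \<ge> real (card V) ^ (4 * n) * (real k / real k ^ (4 * n\<^sup>2 + 5 * n))"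
proof -
  define p where "p = 1 / real k"
  have p: "0 < p" "p \<le> 1/2" "real k * p = 1"
    using k by (auto simp: p_def)
  obtain \<gamma> where \<gamma>: "\<gamma> > 0" and dichotomy: "\<And>(V :: 'a set) w. colouring V k w \<Longrightarrow>
     (\<exists>j X. rich V k w \<gamma> j X) \<or>
     (\<forall>i<k. \<forall>x\<in>V. deg V (w i) x < p\<^sup>2 / 4 \<or> \<gamma> \<le> pentagons V (w i) x)"
    using rich_or_many_pentagons[OF k, of "p\<^sup>2 / 4", where ?'a = 'a] p by auto
  define K where "K = p ^ 5 / \<gamma>"
  define C1 where "C1 = 1 / p ^ 5 + K / p ^ 10"
  define C2 where "C2 = 4 / p + (1 + 2 * K) * (8 / p ^ 10) + 4"
  \<comment> \<open>\<open>A\<close> is the gain per edge of a colour of density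
    \<open>1 / (k - 1/2)\<close> over \<open>1 / k\<close>; \<open>B ^ (5 * n)\<close> will collect
    the losses from the pentagon weights and from the size of \<open>X\<close>.\<close>
  define A where "A = real k / (real k - 1/2)"
  have A: "A > 1"
    using k by (simp add: A_def)
  define B where "B = \<gamma> * real k"
  have B: "B > 0"
    using \<gamma> k by (simp add: B_def)
  \<comment> \<open>\<open>n1\<close> makes \<open>1 / (2 * n)\<close> small enough for the local
    estimate, and \<open>n2\<close> ensures \<open>A ^ (4 * n) * B ^ 5 \<ge> k\<close>, whose
    \<open>n\<close>-th power beats the required factor \<open>k\<close>.\<close>
  obtain n1 where n1: "real n1 > max (2 * C1) (C2 / (2 * p\<^sup>2))"
    using reals_Archimedean2 by blast
  obtain n2 where n2: "real k / B ^ 5 < A ^ n2"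
    using real_arch_pow[OF A] by blast
  define n\<^sub>0 where "n\<^sub>0 = Suc (n1 + n2)"
  have "(\<Sum>i<k. kernel.book V (w i) n) \<ge> real (card V) ^ (4 * n) * (real k / real k ^ (4 * n\<^sup>2 + 5 * n))"
    if n0: "n \<ge> n\<^sub>0" and col: "colouring V k w" for n and V :: "'a set" and w
  proof -
    interpret colouring V k w by fact
    have n: "n \<ge> 1" "n \<ge> n1" "n \<ge> n2"
      using n0 by (auto simp: n\<^sub>0_def)
    define N where "N = real (card V)"
    have N: "0 < N"
      unfolding N_def by (rule card_pos)
    have rhs: "real k / real k ^ (4 * n\<^sup>2 + 5 * n) = real k * p ^ (4 * n\<^sup>2 + 5 * n)"
      by (simp add: p_def power_one_over)
    from dichotomy[OF col] show ?thesis
    proof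
      assume "\<exists>j X. rich V k w \<gamma> j X"
      then obtain j X where rich: "rich V k w \<gamma> j X" by blast
      then have j: "j < k" and X: "X \<subseteq> V" and cX: "\<gamma> * N \<le> real (card X)"
        by (auto simp: rich_def N_def)
      have "0 < \<gamma> * N"
        using \<gamma> N by simp
      then have "X \<noteq> {}"
        using cX by auto
      define \<theta> where "\<theta> = 1 / (real k - 1/2)"
      have \<theta>: "0 \<le> \<theta>" "A = \<theta> * k"
        using k by (auto simp: \<theta>_def A_def)
      have "\<gamma> ^ n * \<theta> ^ (4 * n\<^sup>2) * real (card X) ^ (4 * n) \<le> book j n"
        using rich n X \<open>X \<noteq> {}\<close> \<gamma> \<theta> by (intro book_ge_dense_pair) (auto simp: rich_def \<theta>_def)
      also have "book j n \<le> (\<Sum>i<k. book i n)"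
        using j by (intro member_le_sum) (auto simp: book_def intro: sum_nonneg zero_le_power book_term_nonneg)
      finally have "\<gamma> ^ n * \<theta> ^ (4 * n\<^sup>2) * real (card X) ^ (4 * n) \<le> (\<Sum>i<k. book i n)" .
      moreover have "\<gamma> ^ n * \<theta> ^ (4 * n\<^sup>2) * (\<gamma> * N) ^ (4 * n) \<le> \<gamma> ^ n * \<theta> ^ (4 * n\<^sup>2) * real (card X) ^ (4 * n)"
        using cX \<gamma> \<theta> \<open>0 < \<gamma> * N\<close> by (intro mult_left_mono power_mono) auto
      moreover have "N ^ (4 * n) * (real k * p ^ (4 * n\<^sup>2 + 5 * n)) \<le> \<gamma> ^ n * \<theta> ^ (4 * n\<^sup>2) * (\<gamma> * N) ^ (4 * n)"
      proof -
        have "A ^ n2 \<le> A ^ (4 * n)"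
          using A n by (intro power_increasing) auto
        then have "real k / B ^ 5 \<le> A ^ (4 * n)"
          using n2 by linarith
        then have base: "real k \<le> A ^ (4 * n) * B ^ 5"
          using B by (simp add: field_simps)
        have "real k ^ 1 \<le> real k ^ n"
          using n k by (intro power_increasing) auto
        also have "\<dots> \<le> (A ^ (4 * n) * B ^ 5) ^ n"
          using base by (intro power_mono) auto
        also have "\<dots> = A ^ (4 * n\<^sup>2) * B ^ (5 * n)"
          by (simp add: power_mult_distrib power2_eq_square mult.assoc flip: power_mult)
        finally have "real k * p ^ (4 * n\<^sup>2 + 5 * n) \<le> A ^ (4 * n\<^sup>2) * B ^ (5 * n) * p ^ (4 * n\<^sup>2 + 5 * n)"
          using p by (intro mult_right_mono) auto
        also have "\<dots> = (A * p) ^ (4 * n\<^sup>2) * (B * p) ^ (5 * n)"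
          by (simp add: power_mult_distrib power_add)
        also have "\<dots> = \<theta> ^ (4 * n\<^sup>2) * \<gamma> ^ (5 * n)"
          using p by (simp add: \<theta>(2) B_def mult.assoc)
        finally have "N ^ (4 * n) * (real k * p ^ (4 * n\<^sup>2 + 5 * n)) \<le> N ^ (4 * n) * (\<theta> ^ (4 * n\<^sup>2) * \<gamma> ^ (5 * n))"
          using N by (intro mult_left_mono) auto
        also have "\<gamma> ^ (5 * n) = \<gamma> ^ n * \<gamma> ^ (4 * n)"
          by (simp flip: power_add)
        finally show ?thesis
          by (simp add: power_mult_distrib mult_ac)
      qed
      ultimately show ?thesis
        unfolding rhs N_def by linarith
    next
      assume good: "\<forall>i<k. \<forall>x\<in>V. deg V (w i) x < p\<^sup>2 / 4 \<or> \<gamma> \<le> pentagons V (w i) x"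
      \<comment> \<open>This exponent matches the weights in \<open>book_ge_weighted_C4\<close>.
        Since \<open>10 * \<beta> * n\<^sup>2 = 5 * n\<close>, the power \<open>n\<^sup>2\<close>
        yields exactly the number of pentagon edges.\<close>
      define \<beta> where "\<beta> = 1 / (2 * real n)"
      define P where "P = p powr (10 * \<beta>)"
      define Q where "Q i = avg V (\<lambda>x. avg V (\<lambda>y. pentagons V (w i) x powr \<beta> *
          pentagons V (w i) y powr \<beta> * (codeg V (w i) x y)\<^sup>2))" for i
      have Q_nonneg: "0 \<le> Q i" for i
        unfolding Q_def by (intro avg_nonneg) simp
      have "2 * C1 < n" "C2 / (2 * p\<^sup>2) < n"
        using n1 n by auto
      then have small: "\<beta> * C1 \<le> 1 / 4" "\<beta> * C2 \<le> p\<^sup>2"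
        using n p by (auto simp: \<beta>_def field_simps)
      have Q_ge: "Q i \<ge> P * (p ^ 4 + (4 + 10 * \<beta>) * p ^ 3 * (avg V (deg V (w i)) - p))" if "i < k" for i
        unfolding Q_def P_def
        using p \<gamma> good that small n
        by (intro weighted_C4_ge[where \<gamma> = \<gamma>]) (auto simp: C1_def C2_def K_def \<beta>_def)
      \<comment> \<open>The edge densities sum to 1, so the linear terms cancel in the sum over the
        colours.\<close>
      have "(\<Sum>i<k. avg V (deg V (w i))) = avg V (\<lambda>x. avg V (\<lambda>y. \<Sum>i<k. w i x y))"
        by (simp add: deg_def[abs_def] avg_sum)
      also have "\<dots> = avg V (\<lambda>x. avg V (\<lambda>y. 1))"
        using total by (intro avg_cong) auto
      finally have dens: "(\<Sum>i<k. avg V (deg V (w i)) - p) = 0"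
        using p by (simp add: sum_subtractf)
      have "real k * (P * p ^ 4) = (\<Sum>i<k. P * (p ^ 4 + (4 + 10 * \<beta>) * p ^ 3 * (avg V (deg V (w i)) - p)))"
        using dens by (simp add: distrib_left sum.distrib flip: sum_distrib_left)
      also have "\<dots> \<le> (\<Sum>i<k. Q i)"
        using Q_ge by (intro sum_mono) auto
      finally have "P * p ^ 4 \<le> avg {..<k} Q"
        using k by (simp add: avg_def field_simps)
      \<comment> \<open>Jensen's inequality over the \<open>k\<close> colours passes from the
        average of \<open>Q\<close> to that of its powers.\<close>
      then have "(P * p ^ 4) ^ n\<^sup>2 \<le> avg {..<k} Q ^ n\<^sup>2"
        using p by (intro power_mono) (auto simp: P_def)
      also have "\<dots> \<le> avg {..<k} (\<lambda>i. Q i ^ n\<^sup>2)"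
        using avg_power_le[of "{..<k}" Q "n\<^sup>2 - 1"] Q_nonneg n by simp
      finally have "real k * (P * p ^ 4) ^ n\<^sup>2 \<le> (\<Sum>i<k. Q i ^ n\<^sup>2)"
        using k by (simp add: avg_def field_simps)
      moreover have "(P * p ^ 4) ^ n\<^sup>2 = p ^ (4 * n\<^sup>2 + 5 * n)"
      proof -
        have "P ^ n\<^sup>2 = p powr (10 * \<beta> * real (n\<^sup>2))"
          unfolding P_def using p by (simp add: powr_powr flip: powr_realpow)
        also have "10 * \<beta> * real (n\<^sup>2) = real (5 * n)"
          using n by (simp add: \<beta>_def power2_eq_square)
        also have "p powr real (5 * n) = p ^ (5 * n)"
          using p by (intro powr_realpow) auto
        finally show ?thesis
          by (simp add: power_mult_distrib power_add mult.commute flip: power_mult)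
      qed
      ultimately have "N ^ (4 * n) * (real k * p ^ (4 * n\<^sup>2 + 5 * n)) \<le> N ^ (4 * n) * (\<Sum>i<k. Q i ^ n\<^sup>2)"
        using N by (intro mult_left_mono) auto
      also have "\<dots> \<le> (\<Sum>i<k. book i n)"
        unfolding sum_distrib_left N_def Q_def \<beta>_def using n book_ge_weighted_C4 by (intro sum_mono) simp
      finally show ?thesis
        unfolding rhs N_def .
    qed
  qed
  then show ?thesis
    by (intro exI[of _ n\<^sub>0]) (auto simp: n\<^sub>0_def)
qed

section \<open>Counting homomorphisms\<close>

context kernel
begin

text \<open>The tuple \<open>(b, c, a, e)\<close> stands for the closed walk \<open>x, a, b, c, e, x\<close>; its order is the order
  of summation in \<^const>\<open>pentagons\<close>.\<close>

definition pentagon_tuples :: "'a \<Rightarrow> ('a \<times> 'a \<times> 'a \<times> 'a) set" where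
  "pentagon_tuples x = {(b, c, a, e). b \<in> V \<and> c \<in> V \<and> a \<in> V \<and> e \<in> V \<and>
     u x a = 1 \<and> u a b = 1 \<and> u b c = 1 \<and> u c e = 1 \<and> u e x = 1}"

lemma finite_pentagon_tuples: "finite (pentagon_tuples x)"
  by (rule finite_subset[of _ "V \<times> V \<times> V \<times> V"]) (auto simp: pentagon_tuples_def fin)

lemma card_pentagon_tuples:
  assumes zo: "\<And>x y. u x y \<in> {0, 1}"
  shows "real (card (pentagon_tuples x)) = real (card V) ^ 4 * c5 x"
proof -
  have "real (card (pentagon_tuples x)) = (\<Sum>t\<in>V \<times> V \<times> V \<times> V. of_bool (t \<in> pentagon_tuples x))"
    using fin by (subst sum_of_bool_eq) (auto simp: pentagon_tuples_def intro!: arg_cong[where f = card])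
  also have "\<dots> = (\<Sum>(b, c, a, e)\<in>V \<times> V \<times> V \<times> V. u x a * u a b * u b c * (u c e * u e x))"
  proof (intro sum.cong refl)
    fix t assume "t \<in> V \<times> V \<times> V \<times> V"
    then obtain b c a e where t: "t = (b, c, a, e)" "b \<in> V" "c \<in> V" "a \<in> V" "e \<in> V"
      by auto
    show "of_bool (t \<in> pentagon_tuples x) =
        (case t of (b, c, a, e) \<Rightarrow> u x a * u a b * u b c * (u c e * u e x))"
      using zo[of x a] zo[of a b] zo[of b c] zo[of c e] zo[of e x] t
      by (auto simp: pentagon_tuples_def)
  qed
  also have "\<dots> = (\<Sum>b\<in>V. \<Sum>c\<in>V. \<Sum>a\<in>V. \<Sum>e\<in>V. u x a * u a b * u b c * (u c e * u e x))"
    by (simp add: sum.cartesian_product)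
  also have "\<dots> = real (card V) ^ 4 * c5 x"
    using card_pos
    by (simp add: pentagons_def codeg_def avg_def power4_eq_xxxx
        flip: sum_divide_distrib sum_distrib_left sum_distrib_right)
  finally show ?thesis .
qed

text \<open>These maps may identify vertices, just as the closed walks in \<open>c5\<close> may
  repeat them; injectivity is restored at the cost of a lower-order term.\<close>

definition homs :: "nat \<Rightarrow> (vertex \<Rightarrow> 'a) set" where
  "homs n = {f \<in> vertices (K_C5 n) \<rightarrow>\<^sub>E V.
     (\<forall>a<2 * n. \<forall>b<2 * n. u (f (PartA a)) (f (PartB b)) = 1) \<and>
     (\<forall>i<n. \<forall>j<5. u (f (cycle_vertex i j)) (f (cycle_vertex i (Suc j mod 5))) = 1)}"

lemma finite_homs: "finite (homs n)"
  by (rule finite_subset[of _ "vertices (K_C5 n) \<rightarrow>\<^sub>E V"])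
    (use simple_graph_K_C5[of n] fin in \<open>auto simp: homs_def simple_graph_def intro!: finite_PiE\<close>)

end

section \<open>Assembling homomorphisms from their pieces\<close>

lemma vertices_K_C5:
  shows "PartA m \<in> vertices (K_C5 n) \<longleftrightarrow> m < 2 * n"
    and "PartB m \<in> vertices (K_C5 n) \<longleftrightarrow> m < 2 * n"
    and "New i j \<in> vertices (K_C5 n) \<longleftrightarrow> i < n \<and> 1 \<le> j \<and> j < 5"
proof -
  have "(\<exists>i' j'. New i j = cycle_vertex i' j' \<and> i' < n \<and> j' < 5) \<longleftrightarrow> i < n \<and> 1 \<le> j \<and> j < 5"
    by (rule iffI, force simp: cycle_vertex_def split: if_splits)
      (intro exI[of _ i] exI[of _ j], simp add: cycle_vertex_def)
  then show "New i j \<in> vertices (K_C5 n) \<longleftrightarrow> i < n \<and> 1 \<le> j \<and> j < 5"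
    by (auto simp: K_C5_def)
qed (auto simp: K_C5_def cycle_vertex_def split: if_splits)

text \<open>The tuple is the shared vertex followed by a member of \<open>pentagon_tuples\<close>;
  the index is the position along the cycle, hence the permuted components.\<close>

fun pentagon_vertex :: "'a \<times> 'a \<times> 'a \<times> 'a \<times> 'a \<Rightarrow> nat \<Rightarrow> 'a" where
  "pentagon_vertex (x, b, c, a, d) j =
     (if j = 0 then x else if j = 1 then a else if j = 2 then b else if j = 3 then c else d)"

lemma pentagon_vertex_eqI:
  assumes "\<And>j. j < 5 \<Longrightarrow> pentagon_vertex t j = pentagon_vertex t' j"
  shows "t = t'"
proof -
  obtain x b c a d x' b' c' a' d' where "t = (x, b, c, a, d)" "t' = (x', b', c', a', d')"
    by (cases t, cases t')
  then show ?thesis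
    using assms[of 0] assms[of 1] assms[of 2] assms[of 3] assms[of 4] by simp
qed

text \<open>\<open>y\<close> holds the images of part B, \<open>f\<close> those of the odd vertices
  of part A, and \<open>z i\<close> a whole pentagon including the image of the even vertex
  \<open>2 * i\<close>.\<close>

definition assemble :: "nat \<Rightarrow> (nat \<Rightarrow> 'a) \<Rightarrow> (nat \<Rightarrow> 'a) \<Rightarrow> (nat \<Rightarrow> 'a \<times> 'a \<times> 'a \<times> 'a \<times> 'a) \<Rightarrow> vertex \<Rightarrow> 'a" where
  "assemble n y f z = restrict (\<lambda>v. case v of
      PartA m \<Rightarrow> if even m then pentagon_vertex (z (m div 2)) 0 else f (m div 2)
    | PartB m \<Rightarrow> y m
    | New i j \<Rightarrow> pentagon_vertex (z i) j) (vertices (K_C5 n))"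

lemma assemble_simps:
  "m < 2 * n \<Longrightarrow> assemble n y f z (PartB m) = y m"
  "i < n \<Longrightarrow> assemble n y f z (PartA (2 * i + 1)) = f i"
  "i < n \<Longrightarrow> assemble n y f z (PartA (2 * i)) = pentagon_vertex (z i) 0"
  "i < n \<Longrightarrow> j < 5 \<Longrightarrow> assemble n y f z (cycle_vertex i j) = pentagon_vertex (z i) j"
  by (simp_all add: assemble_def vertices_K_C5 cycle_vertex_def)

context kernel
begin

text \<open>For fixed \<open>y\<close>, each odd vertex has \<open>card (X y)\<close> choices and
  each even vertex with its pentagon \<open>card (Z y)\<close>. By Cauchy-Schwarz the product is at
  least \<open>N ^ 4\<close> times the square of the sum with weights \<open>sqrt (c5 x)\<close> in
  \<open>book\<close>.\<close>

lemma card_homs_ge: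
  assumes zo: "\<And>x y. u x y \<in> {0, 1}"
  shows "real (card V) ^ (4 * n) * book n \<le> real (card (homs n))"
proof -
  define N where "N = real (card V)"
  define Y where "Y = ({..<2 * n} \<rightarrow>\<^sub>E V)"
  define X where "X y = {x\<in>V. \<forall>j<2 * n. u x (y j) = 1}" for y
  define Z where "Z y = (SIGMA x:X y. pentagon_tuples x)" for y
  define S where "S = (SIGMA y:Y. ({..<n} \<rightarrow>\<^sub>E X y) \<times> ({..<n} \<rightarrow>\<^sub>E Z y))"
  have finX: "finite (X y)" for y
    using fin by (simp add: X_def)
  have finZ: "finite (Z y)" for y
    using finX finite_pentagon_tuples by (simp add: Z_def)
  have finY: "finite Y"
    unfolding Y_def using fin by (intro finite_PiE) auto
  have g: "(\<Prod>j<2 * n. u x (y j)) = of_bool (\<forall>j<2 * n. u x (y j) = 1)" for x y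
  proof (cases "\<forall>j<2 * n. u x (y j) = 1")
    case False
    then obtain j where "j < 2 * n" "u x (y j) = 0"
      using zo by blast
    then show ?thesis
      using False by (auto intro!: prod_zero)
  qed simp
  have cX: "real (card (X y)) = (\<Sum>x\<in>V. \<Prod>j<2 * n. u x (y j))" for y
    unfolding g X_def using fin by (simp add: sum_of_bool_eq Collect_conj_eq)
  have cZ: "real (card (Z y)) = (\<Sum>x\<in>V. (\<Prod>j<2 * n. u x (y j)) * (N ^ 4 * c5 x))" for y
  proof -
    have "real (card (Z y)) = (\<Sum>x\<in>X y. N ^ 4 * c5 x)"
      unfolding Z_def using finX finite_pentagon_tuples
      by (simp add: card_SigmaI card_pentagon_tuples[OF zo] N_def)
    also have "\<dots> = (\<Sum>x\<in>V. (\<Prod>j<2 * n. u x (y j)) * (N ^ 4 * c5 x))"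
      unfolding g X_def using fin by (intro sum.mono_neutral_cong_left) auto
    finally show ?thesis .
  qed
  have "real (card S) = (\<Sum>y\<in>Y. (real (card (X y)) * real (card (Z y))) ^ n)"
    unfolding S_def using finY finX finZ
    by (simp add: card_SigmaI finite_PiE card_PiE card_cartesian_product power_mult_distrib)
  also have "\<dots> \<ge> (\<Sum>y\<in>Y. (N ^ 4 * (\<Sum>x\<in>V. sqrt (c5 x) * (\<Prod>j<2 * n. u x (y j)))\<^sup>2) ^ n)"
  proof (intro sum_mono power_mono)
    fix y
    define g where "g x = (\<Prod>j<2 * n. u x (y j))" for x
    have g0: "0 \<le> g x" for x
      unfolding g_def by (intro prod_nonneg) (simp add: nonneg)
    \<comment> \<open>The indicator \<open>g\<close> is split into two square roots, so that the
      squares of the two factors sum to \<open>card (X y)\<close> and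
      \<open>card (Z y)\<close>.\<close>
    have "N ^ 4 * (\<Sum>x\<in>V. sqrt (c5 x) * g x)\<^sup>2 = (\<Sum>x\<in>V. sqrt (g x) * (sqrt (g x) * (N\<^sup>2 * sqrt (c5 x))))\<^sup>2"
    proof -
      have "sqrt (g x) * (sqrt (g x) * (N\<^sup>2 * sqrt (c5 x))) = N\<^sup>2 * (sqrt (c5 x) * g x)" for x
        using g0[of x] by (simp flip: mult.assoc)
      then have "(\<Sum>x\<in>V. sqrt (g x) * (sqrt (g x) * (N\<^sup>2 * sqrt (c5 x)))) = N\<^sup>2 * (\<Sum>x\<in>V. sqrt (c5 x) * g x)"
        by (simp only: sum_distrib_left)
      then show ?thesis
        by (simp add: power_mult_distrib flip: power_mult)
    qed
    also have "\<dots> \<le> (\<Sum>x\<in>V. (sqrt (g x))\<^sup>2) * (\<Sum>x\<in>V. (sqrt (g x) * (N\<^sup>2 * sqrt (c5 x)))\<^sup>2)"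
      by (rule Cauchy_Schwarz_ineq_sum)
    also have "\<dots> = real (card (X y)) * real (card (Z y))"
      using g0 c5_nonneg unfolding cX cZ by (simp add: power_mult_distrib g_def flip: power_mult)
    finally show "N ^ 4 * (\<Sum>x\<in>V. sqrt (c5 x) * (\<Prod>j<2 * n. u x (y j)))\<^sup>2 \<le> real (card (X y)) * real (card (Z y))"
      by (simp add: g_def)
  qed (simp add: N_def)
  also have "(\<Sum>y\<in>Y. (N ^ 4 * (\<Sum>x\<in>V. sqrt (c5 x) * (\<Prod>j<2 * n. u x (y j)))\<^sup>2) ^ n) = N ^ (4 * n) * book n"
    by (simp add: book_def Y_def sum_distrib_left power_mult_distrib flip: power_mult)
  finally have S: "N ^ (4 * n) * book n \<le> real (card S)" .
  define \<Phi> where "\<Phi> = (\<lambda>(y, f, z). assemble n y f z :: vertex \<Rightarrow> 'a)"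
  \<comment> \<open>Every component can be read off from the values at its vertices.\<close>
  have "inj_on \<Phi> S"
  proof (rule inj_onI)
    fix s s' assume s: "s \<in> S" "s' \<in> S" "\<Phi> s = \<Phi> s'"
    obtain y f z y' f' z' where eq: "s = (y, f, z)" "s' = (y', f', z')"
      by (cases s, cases s')
    have \<Phi>: "assemble n y f z v = assemble n y' f' z' v" for v
      using s(3) by (simp add: \<Phi>_def eq)
    have mem: "y \<in> Y" "y' \<in> Y" "f \<in> {..<n} \<rightarrow>\<^sub>E X y" "f' \<in> {..<n} \<rightarrow>\<^sub>E X y'"
        "z \<in> {..<n} \<rightarrow>\<^sub>E Z y" "z' \<in> {..<n} \<rightarrow>\<^sub>E Z y'"
      using s by (auto simp: eq S_def)
    have "y m = y' m" if "m < 2 * n" for m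
      using \<Phi>[of "PartB m"] unfolding assemble_simps(1)[OF that] .
    then have "y = y'"
      using mem unfolding Y_def by (intro PiE_ext[of y "{..<2 * n}" "\<lambda>_. V" y']) auto
    moreover have "f i = f' i" if "i < n" for i
      using \<Phi>[of "PartA (2 * i + 1)"] unfolding assemble_simps(2)[OF that] .
    then have "f = f'"
      using mem \<open>y = y'\<close> by (intro PiE_ext[of f "{..<n}" "\<lambda>_. X y" f']) auto
    moreover have "z i = z' i" if "i < n" for i
    proof (rule pentagon_vertex_eqI)
      show "pentagon_vertex (z i) j = pentagon_vertex (z' i) j" if "j < 5" for j
        using \<Phi>[of "cycle_vertex i j"] unfolding assemble_simps(4)[OF \<open>i < n\<close> that] .
    qed
    then have "z = z'"
      using mem \<open>y = y'\<close> by (intro PiE_ext[of z "{..<n}" "\<lambda>_. Z y" z']) auto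
    ultimately show "s = s'"
      by (simp add: eq)
  qed
  moreover have "\<Phi> ` S \<subseteq> homs n"
  proof safe
    fix y f z assume s: "(y, f, z) \<in> S"
    have y: "y m \<in> V" if "m < 2 * n" for m
      using s that by (auto simp: S_def Y_def)
    have f: "f i \<in> X y" if "i < n" for i
      using s that by (auto simp: S_def)
    have z: "pentagon_vertex (z i) 0 \<in> X y \<and> (\<forall>j<5. pentagon_vertex (z i) j \<in> V \<and>
        u (pentagon_vertex (z i) j) (pentagon_vertex (z i) (Suc j mod 5)) = 1)" if "i < n" for i
    proof -
      have "z i \<in> Z y"
        using s that by (auto simp: S_def)
      then obtain x b c a e where zi: "z i = (x, b, c, a, e)" "x \<in> X y" "(b, c, a, e) \<in> pentagon_tuples x"
        by (auto simp: Z_def)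
      have "pentagon_vertex (z i) j \<in> V \<and>
          u (pentagon_vertex (z i) j) (pentagon_vertex (z i) (Suc j mod 5)) = 1" if "j < 5" for j
      proof -
        have "j = 0 \<or> j = 1 \<or> j = 2 \<or> j = 3 \<or> j = 4"
          using that by linarith
        then show ?thesis
          using zi(2,3) unfolding zi(1) by (elim disjE) (auto simp: X_def pentagon_tuples_def)
      qed
      then show ?thesis
        using zi by simp
    qed
    have A: "assemble n y f z (PartA m) \<in> X y" if "m < 2 * n" for m
    proof (cases "even m")
      case True
      then obtain i where "m = 2 * i" by blast
      then show ?thesis
        using that z[of i] by (simp add: assemble_simps)
    next
      case False
      then obtain i where "m = 2 * i + 1" by (rule oddE)
      then show ?thesis
        using that f[of i] assemble_simps(2)[of i n y f z] by simp
    qed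
    have "assemble n y f z v \<in> V" if v: "v \<in> vertices (K_C5 n)" for v
    proof (cases v)
      case (PartA m)
      then show ?thesis
        using v A[of m] by (auto simp: vertices_K_C5 X_def)
    next
      case (PartB m)
      then show ?thesis
        using v y by (auto simp: vertices_K_C5 assemble_simps)
    next
      case (New i j)
      then have "v = cycle_vertex i j" "i < n" "j < 5"
        using v by (auto simp: vertices_K_C5 cycle_vertex_def)
      then show ?thesis
        using z[of i] by (simp add: assemble_simps)
    qed
    then have "assemble n y f z \<in> vertices (K_C5 n) \<rightarrow>\<^sub>E V"
      by (auto simp: assemble_def)
    then show "\<Phi> (y, f, z) \<in> homs n"
      using A z by (auto simp: \<Phi>_def homs_def assemble_simps X_def)
  qed
  ultimately have "card S \<le> card (homs n)"
    by (metis card_image card_mono finite_homs)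
  then show ?thesis
    using S unfolding N_def by linarith
qed

end

section \<open>From homomorphisms to labeled copies\<close>

text \<open>A collision \<open>f a = f b\<close> makes \<open>f\<close> determined by its
  restriction to \<open>A - {a}\<close>. Summing over the pairs gives the bound; the diagonal
  contributes nothing.\<close>

lemma card_non_injective_le:
  assumes "finite A" "finite B"
  shows "card {f \<in> A \<rightarrow>\<^sub>E B. \<not> inj_on f A} \<le> card A ^ 2 * card B ^ (card A - 1)"
proof -
  define F where "F = (\<lambda>(a, b). {f \<in> A \<rightarrow>\<^sub>E B. a \<noteq> b \<and> f a = f b})"
  have "card (F t) \<le> card B ^ (card A - 1)" if t: "t \<in> A \<times> A" for t
  proof -
    obtain a b where ab: "t = (a, b)" "a \<in> A" "b \<in> A"
      using t by auto
    have "inj_on (\<lambda>f. restrict f (A - {a})) (F t)"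
    proof (rule inj_onI)
      fix f g assume fg: "f \<in> F t" "g \<in> F t" "restrict f (A - {a}) = restrict g (A - {a})"
      have eq: "f x = g x" if "x \<in> A - {a}" for x
        using fun_cong[OF fg(3), of x] that by simp
      have "f a = g a"
        using fg(1,2) eq[of b] ab by (auto simp: F_def)
      then have "f x = g x" if "x \<in> A" for x
        using eq that by (cases "x = a") auto
      then show "f = g"
        using fg(1,2) ab by (intro PiE_ext[of f A "\<lambda>_. B" g]) (auto simp: F_def)
    qed
    moreover have "(\<lambda>f. restrict f (A - {a})) ` F t \<subseteq> (A - {a}) \<rightarrow>\<^sub>E B"
      using ab by (auto simp: F_def split: if_splits)
    moreover have "finite ((A - {a}) \<rightarrow>\<^sub>E B)"
      using assms by (intro finite_PiE) auto
    ultimately have "card (F t) \<le> card ((A - {a}) \<rightarrow>\<^sub>E B)"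
      by (metis card_image card_mono)
    then show ?thesis
      using assms ab by (simp add: card_PiE)
  qed
  then have "(\<Sum>t\<in>A \<times> A. card (F t)) \<le> card (A \<times> A) * card B ^ (card A - 1)"
    using sum_bounded_above[of "A \<times> A" "\<lambda>t. card (F t)"] by simp
  moreover have "card (\<Union>t\<in>A \<times> A. F t) \<le> (\<Sum>t\<in>A \<times> A. card (F t))"
    using assms by (intro card_UN_le) auto
  moreover have "{f \<in> A \<rightarrow>\<^sub>E B. \<not> inj_on f A} = (\<Union>t\<in>A \<times> A. F t)"
    by (auto simp: F_def inj_on_def)
  ultimately show ?thesis
    by (simp add: card_cartesian_product power2_eq_square)
qed

text \<open>Loops receive colour 0, so that the colour classes partition all pairs of vertices.\<close>

definition colour_class :: "('a set \<Rightarrow> nat) \<Rightarrow> nat \<Rightarrow> 'a \<Rightarrow> 'a \<Rightarrow> real" where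
  "colour_class c i x y = of_bool ((if x = y then 0 else c {x, y}) = i)"

lemma colouring_colour_class:
  assumes "c \<in> edge_colorings k (complete_graph N)" "k > 0" "N > 0"
  shows "colouring {..<N} k (colour_class c)"
proof
  fix x y assume "x \<in> {..<N}" "y \<in> {..<N}"
  then have "(if x = y then 0 else c {x, y}) < k"
    using assms by (auto simp: edge_colorings_def complete_graph_def Pi_iff)
  then show "(\<Sum>i<k. colour_class c i x y) = 1"
    unfolding colour_class_def by (simp add: of_bool_def sum.delta)
qed (use assms in \<open>auto simp: colour_class_def insert_commute\<close>)

text \<open>The colours have disjoint sets of homomorphisms because the graph has an edge. Injective
  homomorphisms are monochromatic copies, and the others are absorbed by the error term.\<close>

lemma monochromatic_copies_ge:
  assumes c: "c \<in> edge_colorings k (complete_graph N)" and k: "k > 0" and N: "N > 0" and n: "n > 0"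
  shows "(\<Sum>i<k. card (kernel.homs {..<N} (colour_class c i) n))
    \<le> card (monochromatic_copies (K_C5 n) (complete_graph N) c) + (8 * n)\<^sup>2 * N ^ (8 * n - 1)"
proof -
  interpret colouring "{..<N}" k "colour_class c"
    using c k N by (rule colouring_colour_class)
  define M where "M = monochromatic_copies (K_C5 n) (complete_graph N) c"
  define I where "I = {f \<in> vertices (K_C5 n) \<rightarrow>\<^sub>E {..<N}. \<not> inj_on f (vertices (K_C5 n))}"
  have fin: "finite (vertices (K_C5 n))"
    using simple_graph_K_C5 by (simp add: simple_graph_def)
  have "finite (vertices (K_C5 n) \<rightarrow>\<^sub>E {..<N})"
    using fin by (intro finite_PiE) auto
  then have finM: "finite M" "finite I"
    by (auto simp: M_def I_def monochromatic_copies_def complete_graph_def intro: finite_subset)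
  have disjoint: "homs i n \<inter> homs j n = {}" if "i \<noteq> j" for i j
  proof -
    have False if f: "f \<in> homs i n" "f \<in> homs j n" for f
    proof -
      have "colour_class c i (f (PartA 0)) (f (PartB 0)) = 1" "colour_class c j (f (PartA 0)) (f (PartB 0)) = 1"
        using f n by (auto simp: homs_def)
      then show False
        using \<open>i \<noteq> j\<close> by (simp add: colour_class_def of_bool_def split: if_splits)
    qed
    then show ?thesis by blast
  qed
  have "f \<in> M \<union> I" if f: "f \<in> homs i n" for f i
  proof (cases "inj_on f (vertices (K_C5 n))")
    case False
    then show ?thesis
      using f by (simp add: homs_def I_def)
  next
    case inj: True
    have fV: "f \<in> vertices (K_C5 n) \<rightarrow>\<^sub>E {..<N}"
      using f by (simp add: homs_def)
    have "f ` e \<in> edges (complete_graph N) \<and> c (f ` e) = i" if e: "e \<in> edges (K_C5 n)" for e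
    proof -
      have e2: "e \<subseteq> vertices (K_C5 n)" "card e = 2"
        using e simple_graph_K_C5[of n] by (auto simp: simple_graph_def)
      then have card: "card (f ` e) = 2"
        using inj by (metis card_image inj_on_subset)
      have "f ` e \<subseteq> {..<N}"
        using e2 fV by auto
      moreover obtain p q where pq: "e = {p, q}" "colour_class c i (f p) (f q) = 1"
        using e f unfolding K_C5_def homs_def by auto
      \<comment> \<open>Injectivity makes the image of an edge a genuine pair, so the colour given
        to loops cannot interfere.\<close>
      then have "c (f ` e) = i"
        using card by (cases "f p = f q") (auto simp: colour_class_def)
      ultimately show ?thesis
        using card by (simp add: complete_graph_def)
    qed
    then have "f \<in> M"
      using inj fV by (auto simp: M_def monochromatic_copies_def complete_graph_def)
    then show ?thesis ..
  qed
  then have sub: "(\<Union>i<k. homs i n) \<subseteq> M \<union> I"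
    by blast
  have "(\<Sum>i<k. card (homs i n)) = card (\<Union>i<k. homs i n)"
    using finite_homs disjoint by (subst card_UN_disjoint) auto
  also have "\<dots> \<le> card (M \<union> I)"
    using sub finM by (intro card_mono) auto
  also have "\<dots> \<le> card M + card I"
    by (rule card_Un_le)
  also have "card I \<le> (8 * n)\<^sup>2 * N ^ (8 * n - 1)"
    using card_non_injective_le[OF fin, of "{..<N}"] by (simp add: I_def card_vertices_K_C5)
  finally show ?thesis
    by (simp add: M_def)
qed

theorem theorem1:
  fixes k :: nat
  assumes "k \<ge> 2"
  shows "\<exists>n\<^sub>k\<ge>1. \<forall>n\<ge>n\<^sub>k. k_common k (K_C5 n)"
proof -
  obtain n\<^sub>0 where n0: "n\<^sub>0 \<ge> 1" and book: "\<And>n (V :: nat set) w. n \<ge> n\<^sub>0 \<Longrightarrow> colouring V k w \<Longrightarrow>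
    (\<Sum>i<k. kernel.book V (w i) n) \<ge> real (card V) ^ (4 * n) * (real k / real k ^ (4 * n\<^sup>2 + 5 * n))"
    using total_book_ge[OF assms, where ?'a = nat] by blast
  have "k_common k (K_C5 n)" if n: "n \<ge> n\<^sub>0" for n
    unfolding k_common_def
  proof (intro allI impI)
    fix \<epsilon> :: real assume \<epsilon>: "\<epsilon> > 0"
    define e where "e = 4 * n\<^sup>2 + 5 * n"
    \<comment> \<open>Summing \<open>k\<close> contributions \<open>1 / k ^ e\<close> lowers the
      exponent by one.\<close>
    define D where "D = real k ^ (e - 1)"
    have n1: "n \<ge> 1"
      using n n0 by simp
    have e: "e \<ge> 1"
      using n1 by (simp add: e_def)
    have "real k ^ e = real k * D"
      using e unfolding D_def by (subst power_Suc[symmetric]) simp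
    then have D: "D > 0" "real k / real k ^ e = 1 / D"
      using assms by (simp_all add: D_def)
    \<comment> \<open>From here on, the non-injective maps cost at most a share
      \<open>\<epsilon>\<close> of the main term \<open>N ^ (8 * n) / D\<close>.\<close>
    obtain N\<^sub>0 where N0: "real N\<^sub>0 > (8 * real n)\<^sup>2 * D / \<epsilon>"
      using reals_Archimedean2 by blast
    show "\<forall>\<^sub>F N in sequentially. \<forall>c\<in>edge_colorings k (complete_graph N).
        real (card (monochromatic_copies (K_C5 n) (complete_graph N) c))
          \<ge> (1 - \<epsilon>) * real N ^ card (vertices (K_C5 n)) / real k ^ (card (edges (K_C5 n)) - 1)"
    proof (rule eventually_sequentiallyI[of "max 1 N\<^sub>0"], intro ballI)
      fix N c assume N: "max 1 N\<^sub>0 \<le> N" and c: "c \<in> edge_colorings k (complete_graph N)"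
      define m where "m = real (card (monochromatic_copies (K_C5 n) (complete_graph N) c))"
      interpret colouring "{..<N}" k "colour_class c"
        using c assms N by (intro colouring_colour_class) auto
      \<comment> \<open>One factor \<open>N ^ (4 * n)\<close> belongs to the vertices of the
        complete bipartite graph, the other to the new vertices of the cycles.\<close>
      have "real N ^ (8 * n) * (1 / D) = real N ^ (4 * n) * (real N ^ (4 * n) * (1 / D))"
        by (simp flip: power_add)
      also have "\<dots> \<le> real N ^ (4 * n) * (\<Sum>i<k. book i n)"
        using book[OF n colouring_axioms] unfolding D(2)[symmetric] e_def
        by (intro mult_left_mono) simp_all
      also have "\<dots> \<le> (\<Sum>i<k. real (card (homs i n)))"
        unfolding sum_distrib_left using card_homs_ge zero_one by (intro sum_mono) fastforce
      also have "\<dots> = real (\<Sum>i<k. card (homs i n))"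
        by simp
      also have "\<dots> \<le> real (card (monochromatic_copies (K_C5 n) (complete_graph N) c)
          + (8 * n)\<^sup>2 * N ^ (8 * n - 1))"
        using monochromatic_copies_ge[OF c, of n] assms N n1 by (intro of_nat_mono) auto
      finally have 1: "real N ^ (8 * n) / D - (8 * real n)\<^sup>2 * real N ^ (8 * n - 1) \<le> m"
        by (simp add: m_def)
      have "(8 * real n)\<^sup>2 * D \<le> \<epsilon> * real N"
      proof -
        have "(8 * real n)\<^sup>2 * D / \<epsilon> \<le> real N"
          using N0 N by linarith
        then show ?thesis
          using \<epsilon> by (simp add: field_simps)
      qed
      then have "(8 * real n)\<^sup>2 \<le> \<epsilon> * real N / D"
        using D by (simp add: field_simps)
      then have "(8 * real n)\<^sup>2 * real N ^ (8 * n - 1) \<le> \<epsilon> * real N / D * real N ^ (8 * n - 1)"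
        by (intro mult_right_mono) auto
      also have "\<dots> = \<epsilon> * real N ^ (8 * n) / D"
        using n1 by (simp add: power_eq_if)
      finally have "(1 - \<epsilon>) * real N ^ (8 * n) / D \<le> m"
        using 1 by (simp add: left_diff_distrib diff_divide_distrib)
      then show "(1 - \<epsilon>) * real N ^ card (vertices (K_C5 n)) / real k ^ (card (edges (K_C5 n)) - 1) \<le>
          real (card (monochromatic_copies (K_C5 n) (complete_graph N) c))"
        by (simp add: m_def card_vertices_K_C5 card_edges_K_C5 D_def e_def)
    qed
  qed
  then show ?thesis
    using n0 by blast
qed

end
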